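(* Let $\bar R$ and $R$ be the curvature tensors of $M$ and $\Sigma$ respectively. For $X,Y,Z,V\in T\Sigma$ it holds that $$R(X,Y,Z,V)=X^iY^jZ^kV^l\Big[\bar R_{ijkl}+\big(\hat\nabla_k\Pi_{im}\big)\big(\hat\nabla_l\Pi_j^m\big)-\big(\hat\nabla_l\Pi_{im}\big)\big(\hat\nabla_k\Pi_j^m\big)\Big]$$ $$=\bar R(X,Y,Z,V)+\frac{1}{\gamma^4}\sum_{A=1}^p\Big[\eta\big(\mathcal{B}_A(X),Z\big)\eta\big(\mathcal{B}_A(Y),V\big)-\eta\big(\mathcal{B}_A(X),V\big)\eta\big(\mathcal{B}_A(Y),Z\big)\Big].$$
   Context: $(M,\eta)$ is a Riemannian manifold of dimension $m$ and $\Sigma\subset M$ an $n$-dimensional submanifold with induced metric $g$; $p=m-n$. Local coordinates: $x^1,\dots,x^m$ on $M$ (indices $i,j,k,\dots$, moved with $\eta$), $u^1,\dots,u^n$ on $\Sigma$ (indices $a,b,c,\dots$, moved with $g$); $\Sigma$ is given by $x^i(u^1,\dots,u^n)$, and $x^i$ also denotes the resulting functions on $\Sigma$. Repeated indices are summed. $e_a=(\partial_ax^i)\partial_i$, $g_{ab}=\eta(e_a,e_b)$. $\bar\nabla$ (Christoffel symbols $\bar\Gamma^i_{jk}$) and $\nabla$ are the Levi-Civita connections of $M$ and $\Sigma$. $N_1,\dots,N_p$ is a local orthonormal frame of $T\Sigma^\perp$. "$X\in TM$" means a vector field of $M$ along $\Sigma$; $T\Sigma\subset TM$ via $X^i=X^a\partial_ax^i$.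 $\theta$ is an almost Kähler–Poisson structure on $(\Sigma,g)$: a Poisson bivector for which there is a strictly positive $\gamma\in C^\infty(\Sigma)$ with $\gamma^2g^{ab}=\theta^{ap}\theta^{bq}g_{pq}$; $\{f,h\}=\theta^{ab}(\partial_af)(\partial_bh)$. For $u\in C^\infty(\Sigma)$ set $\mathcal{D}^i(u)=\frac{1}{\gamma^2}\{u,x^k\}\{x^i,x^l\}\eta_{kl}$, $\mathcal{D}^{ik}=\mathcal{D}^i(x^k)$, $\Pi^{ij}=\eta^{ij}-\mathcal{D}^{ij}$, and $\hat\nabla^i=\mathcal{D}^{ik}\bar\nabla_k$, acting on functions by $\hat\nabla^i(u)=\mathcal{D}^i(u)$ and on tensors of $M$ along $\Sigma$ as a covariant derivative (e.g. $\hat\nabla^iX^k=\mathcal{D}^i(X^k)+\mathcal{D}^i(x^l)\bar\Gamma^k_{lm}X^m$, with one Christoffel term for each tensor index). $\mathcal{B}_A^{ij}=-\gamma^2\hat\nabla^iN_A^j$ and $\mathcal{B}_A(X)=\mathcal{B}_A^{ij}X_j\partial_i$. Curvature conventions: $R(Z,V)Y=\nabla_Z\nabla_VY-\nabla_V\nabla_ZY-\nabla_{[Z,V]}Y$, $R(X,Y,Z,V)=\eta(R(Z,V)Y,X)$, similarly for $\bar R$ with $\bar\nabla$, and $\bar R(X,Y,Z,V)=\bar R_{ijkl}X^iY^jZ^kV^l$. *)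

theory Defs
  imports "HOL-Analysis.Analysis"
begin

section \<open>Partial derivatives and smoothness\<close>

definition pd :: "'d \<Rightarrow> (real^'d \<Rightarrow> 'b) \<Rightarrow> real^'d \<Rightarrow> 'b::real_normed_vector" where
  "pd i f u = frechet_derivative f (at u) (axis i 1)"

primrec Ck_on :: "nat \<Rightarrow> (real^'d) set \<Rightarrow> (real^'d \<Rightarrow> 'b::real_normed_vector) \<Rightarrow> bool" where
  "Ck_on 0 S f \<longleftrightarrow> continuous_on S f"
| "Ck_on (Suc k) S f \<longleftrightarrow> f differentiable_on S \<and> (\<forall>i. Ck_on k S (pd i f))"

text \<open>Only used for open sets \<open>S\<close>.\<close>
definition smooth_on :: "(real^'d) set \<Rightarrow> (real^'d \<Rightarrow> 'b::real_normed_vector) \<Rightarrow> bool" where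
  "smooth_on S f \<longleftrightarrow> (\<forall>k. Ck_on k S f)"


section \<open>Manifolds and tensor fields\<close>

text \<open>A chart is a pair of a domain and a coordinate map; the values of the coordinate map
  outside the domain are irrelevant.\<close>
type_synonym ('a, 'd) chart = "'a set \<times> ('a \<Rightarrow> real^'d)"

abbreviation chart_dom :: "('a, 'd) chart \<Rightarrow> 'a set" where
  "chart_dom \<equiv> fst"

abbreviation coord :: "('a, 'd) chart \<Rightarrow> 'a \<Rightarrow> real^'d" where
  "coord \<equiv> snd"

definition chart_inv :: "('a, 'd) chart \<Rightarrow> real^'d \<Rightarrow> 'a" where
  "chart_inv c = inv_into (chart_dom c) (coord c)"

definition is_chart :: "'a topology \<Rightarrow> ('a, 'd::finite) chart \<Rightarrow> bool" where
  "is_chart T c \<longleftrightarrow>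
     openin T (chart_dom c) \<and> open (coord c ` chart_dom c) \<and>
     homeomorphic_map (subtopology T (chart_dom c)) (top_of_set (coord c ` chart_dom c)) (coord c)"

text \<open>The coordinates of \<open>c'\<close> as a function of the coordinates of \<open>c\<close>. With \<open>c\<close> a chart of a
  submanifold and \<open>c'\<close> a chart of the ambient manifold, this is the local parametrization
  \<open>x\<^sup>i(u)\<close> of the submanifold. The relevant domain is
  \<open>coord c ` (chart_dom c \<inter> chart_dom c')\<close>.\<close>
definition coord_change :: "('a, 'd) chart \<Rightarrow> ('a, 'e) chart \<Rightarrow> real^'d \<Rightarrow> real^'e" where
  "coord_change c c' = coord c' \<circ> chart_inv c"

definition smooth_manifold :: "'a topology \<Rightarrow> ('a, 'd::finite) chart set \<Rightarrow> bool" where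
  "smooth_manifold T \<A> \<longleftrightarrow>
     Hausdorff_space T \<and> second_countable T \<and>
     (\<forall>c\<in>\<A>. is_chart T c) \<and>
     topspace T = \<Union> (chart_dom ` \<A>) \<and>
     (\<forall>c\<in>\<A>. \<forall>c'\<in>\<A>. smooth_on (coord c ` (chart_dom c \<inter> chart_dom c')) (coord_change c c'))"

text \<open>Tensor fields are given by their components in every chart of the atlas.\<close>
definition riemannian_manifold ::
  "'a topology \<Rightarrow> ('a, 'm::finite) chart set \<Rightarrow> (('a, 'm) chart \<Rightarrow> real^'m \<Rightarrow> real^'m^'m) \<Rightarrow> bool" where
  "riemannian_manifold T \<A> \<eta> \<longleftrightarrow>
     smooth_manifold T \<A> \<and>
     (\<forall>c\<in>\<A>. smooth_on (coord c ` chart_dom c) (\<eta> c) \<and>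
        (\<forall>p\<in>coord c ` chart_dom c.
           transpose (\<eta> c p) = \<eta> c p \<and> (\<forall>v. v \<noteq> 0 \<longrightarrow> 0 < v \<bullet> (\<eta> c p *v v)))) \<and>
     (\<forall>c\<in>\<A>. \<forall>c'\<in>\<A>. \<forall>p\<in>coord c ` (chart_dom c \<inter> chart_dom c'). \<forall>i j.
        \<eta> c p $ i $ j =
          (\<Sum>k\<in>UNIV. \<Sum>l\<in>UNIV. pd i (coord_change c c') p $ k * pd j (coord_change c c') p $ l *
             \<eta> c' (coord_change c c' p) $ k $ l))"

text \<open>The submanifold carries its own topology, which need not be the subspace topology, so
  both embedded submanifolds and injectively immersed ones are covered.\<close>
definition submanifold ::
  "'a topology \<Rightarrow> ('a, 'm::finite) chart set \<Rightarrow> 'a topology \<Rightarrow> ('a, 'n::finite) chart set \<Rightarrow> bool" where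
  "submanifold TM \<A>M TS \<A>S \<longleftrightarrow>
     smooth_manifold TS \<A>S \<and> topspace TS \<subseteq> topspace TM \<and> continuous_map TS TM id \<and>
     (\<forall>c\<in>\<A>M. \<forall>d\<in>\<A>S.
        smooth_on (coord d ` (chart_dom d \<inter> chart_dom c)) (coord_change d c) \<and>
        (\<forall>u\<in>coord d ` (chart_dom d \<inter> chart_dom c).
           inj (frechet_derivative (coord_change d c) (at u))))"

definition smooth_function :: "('a, 'd::finite) chart set \<Rightarrow> ('a \<Rightarrow> real) \<Rightarrow> bool" where
  "smooth_function \<A> f \<longleftrightarrow> (\<forall>c\<in>\<A>. smooth_on (coord c ` chart_dom c) (f \<circ> chart_inv c))"


section \<open>Poisson brackets\<close>

definition bracket :: "(real^'n \<Rightarrow> real^'n^'n) \<Rightarrow> (real^'n \<Rightarrow> real) \<Rightarrow> (real^'n \<Rightarrow> real) \<Rightarrow> real^'n \<Rightarrow> real" where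
  "bracket \<theta> f h u = (\<Sum>a\<in>UNIV. \<Sum>b\<in>UNIV. \<theta> u $ a $ b * pd a f u * pd b h u)"

definition poisson_bivector ::
  "('a, 'n::finite) chart set \<Rightarrow> (('a, 'n) chart \<Rightarrow> real^'n \<Rightarrow> real^'n^'n) \<Rightarrow> bool" where
  "poisson_bivector \<A> \<theta> \<longleftrightarrow>
     (\<forall>d\<in>\<A>. smooth_on (coord d ` chart_dom d) (\<theta> d) \<and>
        (\<forall>u\<in>coord d ` chart_dom d. transpose (\<theta> d u) = - \<theta> d u) \<and>
        (\<forall>f h k. smooth_on (coord d ` chart_dom d) f \<and> smooth_on (coord d ` chart_dom d) h \<and>
                 smooth_on (coord d ` chart_dom d) k \<longrightarrow>
           (\<forall>u\<in>coord d ` chart_dom d.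
              bracket (\<theta> d) f (bracket (\<theta> d) h k) u + bracket (\<theta> d) h (bracket (\<theta> d) k f) u +
              bracket (\<theta> d) k (bracket (\<theta> d) f h) u = 0))) \<and>
     (\<forall>d\<in>\<A>. \<forall>d'\<in>\<A>. \<forall>u\<in>coord d ` (chart_dom d \<inter> chart_dom d'). \<forall>a b.
        \<theta> d' (coord_change d d' u) $ a $ b =
          (\<Sum>p\<in>UNIV. \<Sum>q\<in>UNIV. pd p (coord_change d d') u $ a * pd q (coord_change d d') u $ b *
             \<theta> d u $ p $ q))"


section \<open>Riemannian geometry in local coordinates\<close>

text \<open>Below, \<open>G\<close> is the component matrix of a metric as a function of the coordinates, and
  vector fields are given by their components.\<close>

definition met :: "(real^'d \<Rightarrow> real^'d^'d) \<Rightarrow> real^'d \<Rightarrow> real^'d \<Rightarrow> real^'d \<Rightarrow> real" where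
  "met G p v w = (\<Sum>i\<in>UNIV. \<Sum>j\<in>UNIV. G p $ i $ j * v $ i * w $ j)"

definition upper :: "(real^'d \<Rightarrow> real^'d^'d) \<Rightarrow> real^'d \<Rightarrow> 'd \<Rightarrow> 'd \<Rightarrow> real" where
  "upper G p i j = matrix_inv (G p) $ i $ j"

text \<open>\<open>christoffel G p i j k\<close> is \<open>\<Gamma>\<^sup>i\<^sub>j\<^sub>k\<close> of the Levi-Civita connection.\<close>
definition christoffel :: "(real^'d \<Rightarrow> real^'d^'d) \<Rightarrow> real^'d \<Rightarrow> 'd \<Rightarrow> 'd \<Rightarrow> 'd \<Rightarrow> real" where
  "christoffel G p i j k =
     (1/2) * (\<Sum>l\<in>UNIV. upper G p i l *
        (pd j (\<lambda>q. G q $ k $ l) p + pd k (\<lambda>q. G q $ j $ l) p - pd l (\<lambda>q. G q $ j $ k) p))"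

definition levi_civita ::
  "(real^'d \<Rightarrow> real^'d^'d) \<Rightarrow> (real^'d \<Rightarrow> real^'d) \<Rightarrow> (real^'d \<Rightarrow> real^'d) \<Rightarrow> real^'d \<Rightarrow> real^'d" where
  "levi_civita G Z Y p = (\<chi> i. \<Sum>j\<in>UNIV. Z p $ j *
     (pd j (\<lambda>q. Y q $ i) p + (\<Sum>k\<in>UNIV. christoffel G p i j k * Y p $ k)))"

definition lie_bracket :: "(real^'d \<Rightarrow> real^'d) \<Rightarrow> (real^'d \<Rightarrow> real^'d) \<Rightarrow> real^'d \<Rightarrow> real^'d" where
  "lie_bracket Z V p =
     (\<chi> i. \<Sum>j\<in>UNIV. Z p $ j * pd j (\<lambda>q. V q $ i) p - V p $ j * pd j (\<lambda>q. Z q $ i) p)"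

definition curvature_op ::
  "(real^'d \<Rightarrow> real^'d^'d) \<Rightarrow> (real^'d \<Rightarrow> real^'d) \<Rightarrow> (real^'d \<Rightarrow> real^'d) \<Rightarrow> (real^'d \<Rightarrow> real^'d) \<Rightarrow>
   real^'d \<Rightarrow> real^'d" where
  "curvature_op G Z V Y p =
     levi_civita G Z (levi_civita G V Y) p - levi_civita G V (levi_civita G Z Y) p
     - levi_civita G (lie_bracket Z V) Y p"

text \<open>\<open>R(X,Y,Z,V)\<close> is the inner product of \<open>R(Z,V)Y\<close> with \<open>X\<close>.\<close>
definition riem ::
  "(real^'d \<Rightarrow> real^'d^'d) \<Rightarrow> (real^'d \<Rightarrow> real^'d) \<Rightarrow> (real^'d \<Rightarrow> real^'d) \<Rightarrow> (real^'d \<Rightarrow> real^'d) \<Rightarrow>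
   (real^'d \<Rightarrow> real^'d) \<Rightarrow> real^'d \<Rightarrow> real" where
  "riem G X Y Z V p = met G p (curvature_op G Z V Y p) (X p)"

definition riem_comp :: "(real^'d \<Rightarrow> real^'d^'d) \<Rightarrow> real^'d \<Rightarrow> 'd \<Rightarrow> 'd \<Rightarrow> 'd \<Rightarrow> 'd \<Rightarrow> real" where
  "riem_comp G p i j k l =
     riem G (\<lambda>_. axis i 1) (\<lambda>_. axis j 1) (\<lambda>_. axis k 1) (\<lambda>_. axis l 1) p"

text \<open>Evaluation on tangent vectors at a single point; unlike \<open>riem\<close> it applies to vector
  fields that are only defined along a submanifold.\<close>
definition riem_at ::
  "(real^'d \<Rightarrow> real^'d^'d) \<Rightarrow> real^'d \<Rightarrow> real^'d \<Rightarrow> real^'d \<Rightarrow> real^'d \<Rightarrow> real^'d \<Rightarrow> real" where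
  "riem_at G p X Y Z V =
     (\<Sum>i\<in>UNIV. \<Sum>j\<in>UNIV. \<Sum>k\<in>UNIV. \<Sum>l\<in>UNIV. riem_comp G p i j k l * X $ i * Y $ j * Z $ k * V $ l)"


section \<open>Submanifolds in local coordinates\<close>

text \<open>\<open>G\<close> is the ambient metric in coordinates \<open>x\<^sup>i\<close>, and \<open>x\<close> the parametrization \<open>x\<^sup>i(u)\<close>. Fields
  along the submanifold are functions of \<open>u\<close>.\<close>

definition induced_metric :: "(real^'m \<Rightarrow> real^'m^'m) \<Rightarrow> (real^'n \<Rightarrow> real^'m) \<Rightarrow> real^'n \<Rightarrow> real^'n^'n" where
  "induced_metric G x u = (\<chi> a b. met G (x u) (pd a x u) (pd b x u))"

definition push :: "(real^'n \<Rightarrow> real^'m) \<Rightarrow> (real^'n \<Rightarrow> real^'n) \<Rightarrow> real^'n \<Rightarrow> real^'m" where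
  "push x X u = (\<chi> i. \<Sum>a\<in>UNIV. X u $ a * pd a (\<lambda>v. x v $ i) u)"

text \<open>Since \<open>p = m - n\<close> fields are required, \<open>N 1, \<dots>, N p\<close> span the normal space.\<close>
definition normal_frame ::
  "(real^'m::finite \<Rightarrow> real^'m^'m) \<Rightarrow> (real^'n::finite \<Rightarrow> real^'m) \<Rightarrow> (real^'n) set \<Rightarrow>
   (nat \<Rightarrow> real^'n \<Rightarrow> real^'m) \<Rightarrow> bool" where
  "normal_frame G x D N \<longleftrightarrow>
     (\<forall>A\<in>{1..CARD('m) - CARD('n)}. smooth_on D (N A) \<and>
        (\<forall>u\<in>D. (\<forall>a. met G (x u) (N A u) (pd a x u) = 0) \<and>
          (\<forall>B\<in>{1..CARD('m) - CARD('n)}. met G (x u) (N A u) (N B u) = (if A = B then 1 else 0))))"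

text \<open>The metric on the submanifold is the induced one. It is expressed through the charts of
  both manifolds; the condition \<open>\<gamma>\<^sup>2 g\<^sup>a\<^sup>b = \<theta>\<^sup>a\<^sup>p \<theta>\<^sup>b\<^sup>q g\<^sub>p\<^sub>q\<close> does not depend on their choice.\<close>
definition almost_kaehler_poisson ::
  "('a, 'm::finite) chart set \<Rightarrow> (('a, 'm) chart \<Rightarrow> real^'m \<Rightarrow> real^'m^'m) \<Rightarrow>
   ('a, 'n::finite) chart set \<Rightarrow> (('a, 'n) chart \<Rightarrow> real^'n \<Rightarrow> real^'n^'n) \<Rightarrow> ('a \<Rightarrow> real) \<Rightarrow> bool" where
  "almost_kaehler_poisson \<A>M \<eta> \<A>S \<theta> \<gamma> \<longleftrightarrow>
     poisson_bivector \<A>S \<theta> \<and> smooth_function \<A>S \<gamma> \<and>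
     (\<forall>d\<in>\<A>S. \<forall>s\<in>chart_dom d. 0 < \<gamma> s) \<and>
     (\<forall>c\<in>\<A>M. \<forall>d\<in>\<A>S. \<forall>s\<in>chart_dom c \<inter> chart_dom d. \<forall>a b.
        (let u = coord d s; g = induced_metric (\<eta> c) (coord_change d c) in
           (\<gamma> s)\<^sup>2 * upper g u a b =
             (\<Sum>p\<in>UNIV. \<Sum>q\<in>UNIV. \<theta> d u $ a $ p * \<theta> d u $ b $ q * g u $ p $ q)))"


section \<open>The derivation \<open>\<D>\<close>, the projection \<open>\<Pi>\<close> and the operators \<open>\<nabla>\<close>-hat and \<open>\<B>\<close>\<close>

text \<open>Throughout, the parameters are the ambient metric \<open>G\<close>, the parametrization \<open>x\<close>, the
  Poisson bivector \<open>\<theta>\<close> and the function \<open>\<gamma>\<close>, the last three as functions of \<open>u\<close>.\<close>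

definition \<D> ::
  "(real^'m \<Rightarrow> real^'m^'m) \<Rightarrow> (real^'n \<Rightarrow> real^'m) \<Rightarrow> (real^'n \<Rightarrow> real^'n^'n) \<Rightarrow> (real^'n \<Rightarrow> real) \<Rightarrow>
   'm \<Rightarrow> (real^'n \<Rightarrow> real) \<Rightarrow> real^'n \<Rightarrow> real" where
  "\<D> G x \<theta> \<gamma> i f u =
     1 / (\<gamma> u)\<^sup>2 * (\<Sum>k\<in>UNIV. \<Sum>l\<in>UNIV.
        bracket \<theta> f (\<lambda>v. x v $ k) u * bracket \<theta> (\<lambda>v. x v $ i) (\<lambda>v. x v $ l) u * G (x u) $ k $ l)"

definition \<Pi>_up ::
  "(real^'m \<Rightarrow> real^'m^'m) \<Rightarrow> (real^'n \<Rightarrow> real^'m) \<Rightarrow> (real^'n \<Rightarrow> real^'n^'n) \<Rightarrow> (real^'n \<Rightarrow> real) \<Rightarrow>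
   'm \<Rightarrow> 'm \<Rightarrow> real^'n \<Rightarrow> real" where
  "\<Pi>_up G x \<theta> \<gamma> i j u = upper G (x u) i j - \<D> G x \<theta> \<gamma> i (\<lambda>v. x v $ j) u"

text \<open>\<open>\<Pi>\<^sub>i\<^sub>m\<close>\<close>
definition \<Pi>_low ::
  "(real^'m \<Rightarrow> real^'m^'m) \<Rightarrow> (real^'n \<Rightarrow> real^'m) \<Rightarrow> (real^'n \<Rightarrow> real^'n^'n) \<Rightarrow> (real^'n \<Rightarrow> real) \<Rightarrow>
   'm \<Rightarrow> 'm \<Rightarrow> real^'n \<Rightarrow> real" where
  "\<Pi>_low G x \<theta> \<gamma> i m u =
     (\<Sum>p\<in>UNIV. \<Sum>q\<in>UNIV. G (x u) $ i $ p * G (x u) $ m $ q * \<Pi>_up G x \<theta> \<gamma> p q u)"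

text \<open>\<open>\<Pi>\<^sub>j\<^sup>m\<close>, with \<open>j\<close> the lower and \<open>m\<close> the upper index\<close>
definition \<Pi>_mix ::
  "(real^'m \<Rightarrow> real^'m^'m) \<Rightarrow> (real^'n \<Rightarrow> real^'m) \<Rightarrow> (real^'n \<Rightarrow> real^'n^'n) \<Rightarrow> (real^'n \<Rightarrow> real) \<Rightarrow>
   'm \<Rightarrow> 'm \<Rightarrow> real^'n \<Rightarrow> real" where
  "\<Pi>_mix G x \<theta> \<gamma> j m u = (\<Sum>p\<in>UNIV. G (x u) $ j $ p * \<Pi>_up G x \<theta> \<gamma> p m u)"

text \<open>\<open>hat_vec\<close>, \<open>hat_low\<close> and \<open>hat_mix\<close> are the action of the covariant derivative with upper
  index \<open>i\<close> on tensors of type \<open>X\<^sup>k\<close>, \<open>T\<^sub>r\<^sub>s\<close> and \<open>T\<^sub>r\<^sup>s\<close>, respectively.\<close>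

definition hat_vec ::
  "(real^'m \<Rightarrow> real^'m^'m) \<Rightarrow> (real^'n \<Rightarrow> real^'m) \<Rightarrow> (real^'n \<Rightarrow> real^'n^'n) \<Rightarrow> (real^'n \<Rightarrow> real) \<Rightarrow>
   'm \<Rightarrow> (real^'n \<Rightarrow> real^'m) \<Rightarrow> 'm \<Rightarrow> real^'n \<Rightarrow> real" where
  "hat_vec G x \<theta> \<gamma> i X k u =
     \<D> G x \<theta> \<gamma> i (\<lambda>v. X v $ k) u +
     (\<Sum>l\<in>UNIV. \<Sum>m\<in>UNIV. \<D> G x \<theta> \<gamma> i (\<lambda>v. x v $ l) u * christoffel G (x u) k l m * X u $ m)"

definition hat_low ::
  "(real^'m \<Rightarrow> real^'m^'m) \<Rightarrow> (real^'n \<Rightarrow> real^'m) \<Rightarrow> (real^'n \<Rightarrow> real^'n^'n) \<Rightarrow> (real^'n \<Rightarrow> real) \<Rightarrow>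
   'm \<Rightarrow> ('m \<Rightarrow> 'm \<Rightarrow> real^'n \<Rightarrow> real) \<Rightarrow> 'm \<Rightarrow> 'm \<Rightarrow> real^'n \<Rightarrow> real" where
  "hat_low G x \<theta> \<gamma> i T r s u =
     \<D> G x \<theta> \<gamma> i (T r s) u
     - (\<Sum>l\<in>UNIV. \<Sum>m\<in>UNIV. \<D> G x \<theta> \<gamma> i (\<lambda>v. x v $ l) u * christoffel G (x u) m l r * T m s u)
     - (\<Sum>l\<in>UNIV. \<Sum>m\<in>UNIV. \<D> G x \<theta> \<gamma> i (\<lambda>v. x v $ l) u * christoffel G (x u) m l s * T r m u)"

definition hat_mix ::
  "(real^'m \<Rightarrow> real^'m^'m) \<Rightarrow> (real^'n \<Rightarrow> real^'m) \<Rightarrow> (real^'n \<Rightarrow> real^'n^'n) \<Rightarrow> (real^'n \<Rightarrow> real) \<Rightarrow>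
   'm \<Rightarrow> ('m \<Rightarrow> 'm \<Rightarrow> real^'n \<Rightarrow> real) \<Rightarrow> 'm \<Rightarrow> 'm \<Rightarrow> real^'n \<Rightarrow> real" where
  "hat_mix G x \<theta> \<gamma> i T r s u =
     \<D> G x \<theta> \<gamma> i (T r s) u
     - (\<Sum>l\<in>UNIV. \<Sum>m\<in>UNIV. \<D> G x \<theta> \<gamma> i (\<lambda>v. x v $ l) u * christoffel G (x u) m l r * T m s u)
     + (\<Sum>l\<in>UNIV. \<Sum>m\<in>UNIV. \<D> G x \<theta> \<gamma> i (\<lambda>v. x v $ l) u * christoffel G (x u) s l m * T r m u)"

definition nabla_\<Pi>_low ::
  "(real^'m \<Rightarrow> real^'m^'m) \<Rightarrow> (real^'n \<Rightarrow> real^'m) \<Rightarrow> (real^'n \<Rightarrow> real^'n^'n) \<Rightarrow> (real^'n \<Rightarrow> real) \<Rightarrow>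
   'm \<Rightarrow> 'm \<Rightarrow> 'm \<Rightarrow> real^'n \<Rightarrow> real" where
  "nabla_\<Pi>_low G x \<theta> \<gamma> k i m u =
     (\<Sum>r\<in>UNIV. G (x u) $ k $ r * hat_low G x \<theta> \<gamma> r (\<Pi>_low G x \<theta> \<gamma>) i m u)"

definition nabla_\<Pi>_mix ::
  "(real^'m \<Rightarrow> real^'m^'m) \<Rightarrow> (real^'n \<Rightarrow> real^'m) \<Rightarrow> (real^'n \<Rightarrow> real^'n^'n) \<Rightarrow> (real^'n \<Rightarrow> real) \<Rightarrow>
   'm \<Rightarrow> 'm \<Rightarrow> 'm \<Rightarrow> real^'n \<Rightarrow> real" where
  "nabla_\<Pi>_mix G x \<theta> \<gamma> l j m u =
     (\<Sum>r\<in>UNIV. G (x u) $ l $ r * hat_mix G x \<theta> \<gamma> r (\<Pi>_mix G x \<theta> \<gamma>) j m u)"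

text \<open>With \<open>\<nu> = N\<^sub>A\<close> these are the components \<open>\<B>\<^sub>A\<^sup>i\<^sup>j\<close> and the map \<open>X \<mapsto> \<B>\<^sub>A(X)\<close> at the point \<open>u\<close>.\<close>
definition \<B>_comp ::
  "(real^'m \<Rightarrow> real^'m^'m) \<Rightarrow> (real^'n \<Rightarrow> real^'m) \<Rightarrow> (real^'n \<Rightarrow> real^'n^'n) \<Rightarrow> (real^'n \<Rightarrow> real) \<Rightarrow>
   (real^'n \<Rightarrow> real^'m) \<Rightarrow> real^'n \<Rightarrow> 'm \<Rightarrow> 'm \<Rightarrow> real" where
  "\<B>_comp G x \<theta> \<gamma> \<nu> u i j = - (\<gamma> u)\<^sup>2 * hat_vec G x \<theta> \<gamma> i \<nu> j u"

definition \<B> ::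
  "(real^'m \<Rightarrow> real^'m^'m) \<Rightarrow> (real^'n \<Rightarrow> real^'m) \<Rightarrow> (real^'n \<Rightarrow> real^'n^'n) \<Rightarrow> (real^'n \<Rightarrow> real) \<Rightarrow>
   (real^'n \<Rightarrow> real^'m) \<Rightarrow> real^'n \<Rightarrow> real^'m \<Rightarrow> real^'m" where
  "\<B> G x \<theta> \<gamma> \<nu> u X =
     (\<chi> i. \<Sum>j\<in>UNIV. \<Sum>k\<in>UNIV. \<B>_comp G x \<theta> \<gamma> \<nu> u i j * G (x u) $ j $ k * X $ k)"

end

theory Submission
  imports Defs
begin

text \<open>
  Everything is computed in one chart of each manifold. A vector field of the ambient space along
  the submanifold is a function \<open>W\<close> of \<open>u\<close>, and \<open>cov \<Gamma> x a W\<close> is its covariant derivative along the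
  coordinate curve \<open>u\<^sup>a\<close>. Three facts about this derivative carry the proof of the Gauss equation.

  \<^item> It satisfies the Ricci identity (\<open>ricci_identity\<close>): the commutator of two such derivatives is the
    curvature of the connection, evaluated on the coordinate tangent vectors. With \<open>x\<close> the identity
    map this also shows that the curvature operator of a metric is a tensor.
  \<^item> It is compatible with the metric (\<open>pd_met\<close>).
  \<^item> The tangential part of the derivative of a tangential field is the intrinsic derivative
    (\<open>gauss_formula\<close>), because both are given by Koszul's formula.

  Differentiate a tangential field \<open>Y\<close> twice and pair the result with a tangential field \<open>X\<close>. The
  intrinsic second derivative differs from the ambient one by the derivative of the normal part of
  \<open>\<nabla>\<^sub>j Y\<close>. Since this normal part is orthogonal to \<open>X\<close>, the derivative can be moved to \<open>X\<close>,
  which yields the product of the normal parts of \<open>\<nabla>\<^sub>j Y\<close> and \<open>\<nabla>\<^sub>k X\<close>. Commuting the two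
  derivatives gives \<open>gauss_equation\<close>: the two curvatures differ by
  \<open>\<langle>II(Z,X), II(V,Y)\<rangle> - \<langle>II(V,X), II(Z,Y)\<rangle>\<close>, where \<open>II(Z,X)\<close> is the normal part of \<open>\<nabla>\<^sub>Z X\<close>.

  It remains to recognise these products in the two expressions built from the Poisson bracket.
  The condition \<open>\<gamma>\<^sup>2 g\<^sup>a\<^sup>b = \<theta>\<^sup>a\<^sup>p \<theta>\<^sup>b\<^sup>q g\<^sub>p\<^sub>q\<close> says exactly that \<open>\<D>\<^sup>i(f)\<close> is the gradient of \<open>f\<close> on the
  submanifold (\<open>\<D>_eq\<close>). So the contraction of the hat derivative with a tangential \<open>Z\<close> is \<open>\<nabla>\<^sub>Z\<close>, and
  \<open>\<Pi>\<close> is the orthogonal projection onto the normal space.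
  Differentiating \<open>X\<^sup>i \<Pi>\<^sub>i\<^sub>m = 0\<close> shows that the derivative of \<open>\<Pi>\<close>, contracted with \<open>X\<close> and \<open>Z\<close>, is
  \<open>-II(Z,X)\<close> (\<open>contract_nabla_\<Pi>_mix\<close>, \<open>contract_nabla_\<Pi>_low\<close>). Differentiating \<open>\<langle>N\<^sub>A, X\<rangle> = 0\<close> shows
  that \<open>\<langle>\<B>\<^sub>A(X), Z\<rangle> = \<gamma>\<^sup>2 \<langle>N\<^sub>A, \<nabla>\<^sub>Z X\<rangle>\<close> (\<open>ip_\<B>\<close>), and summing over an orthonormal frame of the
  normal space recovers the products of normal parts (\<open>orthonormal_complement_expansion\<close>).
\<close>

section \<open>Calculus of partial derivatives\<close>

lemma pd_eqI: "(f has_derivative f') (at u) \<Longrightarrow> pd i f u = f' (axis i 1)"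
  unfolding pd_def using frechet_derivative_at by metis

lemma frechet_derivative_eq_sum_pd:
  fixes f :: "real^'d \<Rightarrow> 'b::real_normed_vector"
  assumes "f differentiable at u"
  shows "frechet_derivative f (at u) v = (\<Sum>i\<in>UNIV. v $ i *\<^sub>R pd i f u)"
proof -
  interpret linear "frechet_derivative f (at u)"
    using assms by (rule linear_frechet_derivative)
  have "frechet_derivative f (at u) v = frechet_derivative f (at u) (\<Sum>i\<in>UNIV. v $ i *\<^sub>R axis i 1)"
    by (simp add: basis_expansion flip: scalar_mult_eq_scaleR)
  then show ?thesis by (simp add: sum scaleR pd_def)
qed

lemma pd_cong_open:
  assumes "open S" "u \<in> S" "\<And>v. v \<in> S \<Longrightarrow> f v = h v"
  shows "pd i f u = pd i h u"
proof (cases "f differentiable at u")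
  case True
  have "(h has_derivative frechet_derivative f (at u)) (at u)"
    using True assms frechet_derivative_works has_derivative_transform_within_open by blast
  then show ?thesis unfolding pd_def by (metis frechet_derivative_at)
next
  case False
  have "(f has_derivative f') (at u) \<longleftrightarrow> (h has_derivative f') (at u)" for f'
    using assms has_derivative_transform_within_open[of f f' u UNIV S h]
      has_derivative_transform_within_open[of h f' u UNIV S f] by auto
  then show ?thesis unfolding pd_def frechet_derivative_def by simp
qed

lemma differentiable_cong_open:
  assumes "open S" "u \<in> S" "\<And>v. v \<in> S \<Longrightarrow> f v = h v" "h differentiable at u"
  shows "f differentiable at u"
  using assms has_derivative_transform_within_open[of h _ u UNIV S f]
  unfolding differentiable_def by metis

lemma differentiable_vec_nth [simp]:
  "f differentiable at u \<Longrightarrow> (\<lambda>v. f v $ i) differentiable at u"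
  by (rule differentiable_compose[of "\<lambda>w. w $ i"])
    (auto intro!: bounded_linear_imp_differentiable bounded_linear_vec_nth)

lemma differentiable_sum':
  assumes "\<And>j. j \<in> I \<Longrightarrow> f j differentiable at u"
  shows "(\<lambda>v. \<Sum>j\<in>I. f j v) differentiable at u"
  using assms
  by (induction I rule: infinite_finite_induct) (auto)

lemma differentiable_vec_lambda:
  fixes f :: "'d::real_normed_vector \<Rightarrow> real^'m"
  assumes "\<And>i. (\<lambda>v. f v $ i) differentiable at u"
  shows "f differentiable at u"
proof -
  have eq: "f = (\<lambda>v. \<Sum>i\<in>UNIV. f v $ i *\<^sub>R axis i 1)"
    by (simp add: fun_eq_iff basis_expansion flip: scalar_mult_eq_scaleR)
  have d: "(\<lambda>v. \<Sum>i\<in>UNIV. f v $ i *\<^sub>R axis i (1::real)) differentiable at u"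
    using assms by (intro differentiable_sum' differentiable_scaleR) auto
  show ?thesis by (subst eq) (rule d)
qed

lemma pd_vec_nth:
  assumes "f differentiable at u"
  shows "pd i (\<lambda>v. f v $ j) u = pd i f u $ j"
proof -
  have "(f has_derivative frechet_derivative f (at u)) (at u)"
    using assms frechet_derivative_works by blast
  then have "((\<lambda>v. f v $ j) has_derivative (\<lambda>h. frechet_derivative f (at u) h $ j)) (at u)"
    by (rule bounded_linear.has_derivative[OF bounded_linear_vec_nth])
  then show ?thesis by (metis pd_eqI pd_def)
qed

lemma pd_const [simp]: "pd i (\<lambda>_. k) u = 0"
  by (rule pd_eqI[where f' = "\<lambda>_. 0"]) (auto intro: derivative_eq_intros)

lemma pd_id [simp]: "pd i (\<lambda>v. v) u = axis i 1"
  by (rule pd_eqI[where f' = "\<lambda>v. v"]) (auto intro: derivative_eq_intros)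

lemma differentiable_has_derivative:
  "f differentiable at u \<Longrightarrow> (f has_derivative frechet_derivative f (at u)) (at u)"
  using frechet_derivative_works by blast

lemma pd_add:
  assumes "f differentiable at u" "h differentiable at u"
  shows "pd i (\<lambda>v. f v + h v) u = pd i f u + pd i h u"
  using pd_eqI[OF has_derivative_add[OF assms[THEN differentiable_has_derivative]]]
  by (simp add: pd_def)

lemma pd_diff:
  assumes "f differentiable at u" "h differentiable at u"
  shows "pd i (\<lambda>v. f v - h v) u = pd i f u - pd i h u"
  using pd_eqI[OF has_derivative_diff[OF assms[THEN differentiable_has_derivative]]]
  by (simp add: pd_def)

lemma pd_mult:
  fixes f h :: "real^'d \<Rightarrow> real"
  assumes "f differentiable at u" "h differentiable at u"
  shows "pd i (\<lambda>v. f v * h v) u = pd i f u * h u + f u * pd i h u"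
  using pd_eqI[OF has_derivative_mult[OF assms[THEN differentiable_has_derivative]]]
  by (simp add: pd_def)

lemma pd_scaleR:
  fixes f :: "real^'d \<Rightarrow> real"
  assumes "f differentiable at u" "h differentiable at u"
  shows "pd i (\<lambda>v. f v *\<^sub>R h v) u = pd i f u *\<^sub>R h u + f u *\<^sub>R pd i h u"
  using pd_eqI[OF has_derivative_scaleR[OF assms[THEN differentiable_has_derivative]]]
  by (simp add: pd_def)

lemma pd_sum:
  assumes "finite I" "\<And>j. j \<in> I \<Longrightarrow> f j differentiable at u"
  shows "pd i (\<lambda>v. \<Sum>j\<in>I. f j v) u = (\<Sum>j\<in>I. pd i (f j) u)"
  using pd_eqI[OF has_derivative_sum, OF assms(2)[THEN differentiable_has_derivative]]
  by (simp add: pd_def)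

lemma pd_chain:
  fixes x :: "real^'n \<Rightarrow> real^'m" and f :: "real^'m \<Rightarrow> 'b::real_normed_vector"
  assumes "x differentiable at u" "f differentiable at (x u)"
  shows "pd a (\<lambda>v. f (x v)) u = (\<Sum>k\<in>UNIV. pd a x u $ k *\<^sub>R pd k f (x u))"
proof -
  have "((\<lambda>v. f (x v)) has_derivative
      (\<lambda>h. frechet_derivative f (at (x u)) (frechet_derivative x (at u) h))) (at u)"
    using diff_chain_at[OF assms[THEN differentiable_has_derivative]] by (simp add: o_def)
  then have "pd a (\<lambda>v. f (x v)) u = frechet_derivative f (at (x u)) (pd a x u)"
    using pd_eqI unfolding pd_def by blast
  then show ?thesis using frechet_derivative_eq_sum_pd[OF assms(2)] by simp
qed

lemma differentiable_chain:
  assumes "x differentiable at u" "f differentiable at (x u)"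
  shows "(\<lambda>v. f (x v)) differentiable at u"
  using differentiable_chain_at[OF assms] by (simp add: o_def)

lemma differentiable_trilinear:
  fixes A :: "'d::real_normed_vector \<Rightarrow> real^'p" and B :: "'d \<Rightarrow> real^'q"
  assumes "\<And>j k. F j k differentiable at u" "A differentiable at u" "B differentiable at u"
  shows "(\<lambda>v. \<Sum>j\<in>UNIV. \<Sum>k\<in>UNIV. F j k v * A v $ j * B v $ k :: real) differentiable at u"
  using assms by (intro differentiable_sum' differentiable_mult) auto

text \<open>Both the Christoffel term of a covariant derivative and the metric pairing of two fields
  along a map are of this form.\<close>
lemma pd_trilinear:
  fixes A :: "real^'d \<Rightarrow> real^'p" and B :: "real^'d \<Rightarrow> real^'q"
  assumes "\<And>j k. F j k differentiable at u" "A differentiable at u" "B differentiable at u"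
  shows "pd c (\<lambda>v. \<Sum>j\<in>UNIV. \<Sum>k\<in>UNIV. F j k v * A v $ j * B v $ k :: real) u =
    (\<Sum>j\<in>UNIV. \<Sum>k\<in>UNIV. pd c (F j k) u * A u $ j * B u $ k) +
    (\<Sum>j\<in>UNIV. \<Sum>k\<in>UNIV. F j k u * pd c A u $ j * B u $ k) +
    (\<Sum>j\<in>UNIV. \<Sum>k\<in>UNIV. F j k u * A u $ j * pd c B u $ k)"
  using assms
  by (simp add: pd_sum pd_mult pd_vec_nth differentiable_sum' differentiable_mult
      algebra_simps sum.distrib)

lemma Ck_on_SucD:
  assumes "Ck_on (Suc k) S f" "open S"
  shows "u \<in> S \<Longrightarrow> f differentiable at u" "Ck_on k S (pd i f)"
  using assms by (auto simp: differentiable_on_eq_differentiable_at)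

lemma Ck_on_2D:
  assumes "Ck_on 2 S f" "open S" "u \<in> S"
  shows "f differentiable at u" "pd a f differentiable at u"
  using assms Ck_on_SucD[of 1 S f] Ck_on_SucD(1)[of 0 S "pd a f"] by (auto simp: numeral_2_eq_2)

lemma Ck_on_Suc_imp: "open S \<Longrightarrow> Ck_on (Suc k) S f \<Longrightarrow> Ck_on k S f"
proof (induction k arbitrary: f)
  case 0
  then show ?case by (simp add: differentiable_imp_continuous_on)
next
  case (Suc k)
  then show ?case by (metis Ck_on.simps(2))
qed

lemma smooth_on_subset:
  assumes "smooth_on S f" "T \<subseteq> S"
  shows "smooth_on T f"
proof -
  have "Ck_on k S f \<Longrightarrow> Ck_on k T f" for k and f :: "real^'a \<Rightarrow> 'b"
    using \<open>T \<subseteq> S\<close>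
    by (induction k arbitrary: f) (auto intro: continuous_on_subset differentiable_on_subset)
  then show ?thesis using assms by (auto simp: smooth_on_def)
qed

lemma Ck_on_const [simp]: "Ck_on k S (\<lambda>_. c)"
  by (induction k arbitrary: c) (auto simp: pd_const[abs_def])

lemma Ck_on_id: "Ck_on k S (\<lambda>q. q)"
  by (cases k) (auto simp: pd_id[abs_def])

lemma has_real_derivative_along_line:
  fixes f :: "real^'d \<Rightarrow> real"
  assumes "f differentiable at (p + s *\<^sub>R axis i 1)"
  shows "((\<lambda>t. f (p + t *\<^sub>R axis i 1)) has_real_derivative pd i f (p + s *\<^sub>R axis i 1)) (at s)"
proof -
  let ?l = "\<lambda>t. p + t *\<^sub>R axis i (1::real)"
  have "(?l has_derivative (\<lambda>t. t *\<^sub>R axis i 1)) (at s)"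
    by (auto intro!: derivative_eq_intros)
  from diff_chain_at[OF this differentiable_has_derivative[OF assms]]
  have "((\<lambda>t. f (?l t)) has_derivative (\<lambda>t. frechet_derivative f (at (?l s)) (t *\<^sub>R axis i 1))) (at s)"
    by (simp add: o_def)
  moreover have "frechet_derivative f (at (?l s)) (t *\<^sub>R axis i 1) = pd i f (?l s) * t" for t
    using linear_scale[OF linear_frechet_derivative[OF assms]] by (simp add: pd_def)
  ultimately show ?thesis by (simp add: has_field_derivative_def)
qed

text \<open>The second difference of \<open>f\<close> over a square is reached by two applications
  of the mean value theorem, first in direction \<open>a\<close> and then in direction
  \<open>b\<close>. As it is symmetric in \<open>a\<close> and \<open>b\<close>, the two mixed
  derivatives take equal values at points arbitrarily close to \<open>u\<close>.\<close>
lemma second_difference_MVT: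
  fixes f :: "real^'d \<Rightarrow> real"
  assumes C: "Ck_on 2 S f" and S: "open S" and h: "0 < h"
    and sq: "\<And>s t. \<lbrakk>0 \<le> s; s \<le> h; 0 \<le> t; t \<le> h\<rbrakk> \<Longrightarrow> u + s *\<^sub>R axis a 1 + t *\<^sub>R axis b 1 \<in> S"
  shows "\<exists>s t. 0 < s \<and> s < h \<and> 0 < t \<and> t < h \<and>
    f (u + h *\<^sub>R axis a 1 + h *\<^sub>R axis b 1) - f (u + h *\<^sub>R axis a 1) - f (u + h *\<^sub>R axis b 1) + f u
      = h * h * pd b (pd a f) (u + s *\<^sub>R axis a 1 + t *\<^sub>R axis b 1)"
proof -
  let ?p = "\<lambda>s t. u + s *\<^sub>R axis a (1::real) + t *\<^sub>R axis b 1"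
  have d1: "f differentiable at w" if "w \<in> S" for w
    using Ck_on_2D(1)[OF C S that] .
  have d2: "pd a f differentiable at w" if "w \<in> S" for w
    using Ck_on_2D(2)[OF C S that] .
  have "((\<lambda>s. f (?p s t)) has_real_derivative pd a f (?p s t)) (at s)"
    if "0 \<le> s" "s \<le> h" "0 \<le> t" "t \<le> h" for s t
    using has_real_derivative_along_line[where f = f and p = "u + t *\<^sub>R axis b 1" and s = s and i = a] d1[OF sq[OF that]]
    by (simp add: add_ac)
  note d_a = this
  have "((\<lambda>s. f (?p s h) - f (?p s 0)) has_real_derivative (pd a f (?p s h) - pd a f (?p s 0))) (at s)"
    if "0 \<le> s" "s \<le> h" for s
    using DERIV_diff[OF d_a[of s h] d_a[of s 0]] that h by simp
  then obtain s where s: "0 < s" "s < h"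
    "(f (?p h h) - f (?p h 0)) - (f (?p 0 h) - f (?p 0 0)) = h * (pd a f (?p s h) - pd a f (?p s 0))"
    using MVT2[OF h, of "\<lambda>s. f (?p s h) - f (?p s 0)" "\<lambda>s. pd a f (?p s h) - pd a f (?p s 0)"] by auto
  have "((\<lambda>t. pd a f (?p s t)) has_real_derivative pd b (pd a f) (?p s t)) (at t)"
    if "0 \<le> t" "t \<le> h" for t
    using has_real_derivative_along_line[where f = "pd a f" and p = "u + s *\<^sub>R axis a 1" and s = t and i = b] d2[OF sq[of s t]] that s
    by simp
  then obtain t where t: "0 < t" "t < h" "pd a f (?p s h) - pd a f (?p s 0) = h * pd b (pd a f) (?p s t)"
    using MVT2[OF h, of "\<lambda>t. pd a f (?p s t)" "\<lambda>t. pd b (pd a f) (?p s t)"] by auto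
  show ?thesis using s t by (intro exI[of _ s] exI[of _ t]) (auto simp: algebra_simps)
qed

lemma pd_commute_real:
  fixes f :: "real^'d \<Rightarrow> real"
  assumes C: "Ck_on 2 S f" and S: "open S" and u: "u \<in> S"
  shows "pd a (pd b f) u = pd b (pd a f) u"
proof (rule ccontr)
  assume ne: "pd a (pd b f) u \<noteq> pd b (pd a f) u"
  let ?e = "\<bar>pd a (pd b f) u - pd b (pd a f) u\<bar> / 2"
  have c: "continuous (at u) (pd i (pd j f))" for i j
    using C S u by (auto simp: numeral_2_eq_2 continuous_on_eq_continuous_at)
  obtain r0 where r0: "r0 > 0" "ball u r0 \<subseteq> S" using S u by (meson openE)
  obtain r1 where r1: "r1 > 0" "\<And>w. dist w u < r1 \<Longrightarrow> dist (pd a (pd b f) w) (pd a (pd b f) u) < ?e"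
    using c[of a b] ne unfolding continuous_at_eps_delta
    by (metis zero_less_abs_iff eq_iff_diff_eq_0 half_gt_zero)
  obtain r2 where r2: "r2 > 0" "\<And>w. dist w u < r2 \<Longrightarrow> dist (pd b (pd a f) w) (pd b (pd a f) u) < ?e"
    using c[of b a] ne unfolding continuous_at_eps_delta
    by (metis zero_less_abs_iff eq_iff_diff_eq_0 half_gt_zero)
  \<comment> \<open>The points of a square of side \<open>h\<close> with corner \<open>u\<close> have distance at most \<open>2 * h\<close> from \<open>u\<close>.\<close>
  define h where "h = min r0 (min r1 r2) / 3"
  have h: "0 < h" "2 * h < r0" "2 * h < r1" "2 * h < r2" using r0 r1 r2 by (auto simp: h_def)
  have near: "dist (u + s *\<^sub>R axis i 1 + t *\<^sub>R axis j 1) u \<le> 2 * h"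
    if "0 \<le> s" "s \<le> h" "0 \<le> t" "t \<le> h" for s t and i j :: 'd
  proof -
    have "norm (s *\<^sub>R axis i (1::real) + t *\<^sub>R axis j 1) \<le> s + t"
      using norm_triangle_ineq[of "s *\<^sub>R axis i (1::real)" "t *\<^sub>R axis j 1"] that by simp
    then show ?thesis using that by (simp add: dist_norm add.assoc)
  qed
  have sq: "u + s *\<^sub>R axis i 1 + t *\<^sub>R axis j 1 \<in> S"
    if "0 \<le> s" "s \<le> h" "0 \<le> t" "t \<le> h" for s t and i j :: 'd
    using near[OF that, of i j] h r0 by (auto simp: subset_iff dist_commute)
  obtain s t where st: "0 < s" "s < h" "0 < t" "t < h" and 1:
    "f (u + h *\<^sub>R axis a 1 + h *\<^sub>R axis b 1) - f (u + h *\<^sub>R axis a 1) - f (u + h *\<^sub>R axis b 1) + f u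
      = h * h * pd b (pd a f) (u + s *\<^sub>R axis a 1 + t *\<^sub>R axis b 1)"
    using second_difference_MVT[OF C S h(1), of u a b] sq by blast
  obtain s' t' where st': "0 < s'" "s' < h" "0 < t'" "t' < h" and 2:
    "f (u + h *\<^sub>R axis b 1 + h *\<^sub>R axis a 1) - f (u + h *\<^sub>R axis b 1) - f (u + h *\<^sub>R axis a 1) + f u
      = h * h * pd a (pd b f) (u + s' *\<^sub>R axis b 1 + t' *\<^sub>R axis a 1)"
    using second_difference_MVT[OF C S h(1), of u b a] sq by blast
  have "u + h *\<^sub>R axis a 1 + h *\<^sub>R axis b (1::real) = u + h *\<^sub>R axis b 1 + h *\<^sub>R axis a 1"
    by (simp add: add_ac)
  note 1 = 1[unfolded this]
  have "h * h * pd b (pd a f) (u + s *\<^sub>R axis a 1 + t *\<^sub>R axis b 1) =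
      h * h * pd a (pd b f) (u + s' *\<^sub>R axis b 1 + t' *\<^sub>R axis a 1)"
    using 1 2 by linarith
  then have "pd b (pd a f) (u + s *\<^sub>R axis a 1 + t *\<^sub>R axis b 1) =
      pd a (pd b f) (u + s' *\<^sub>R axis b 1 + t' *\<^sub>R axis a 1)"
    using h by simp
  moreover have "dist (pd b (pd a f) (u + s *\<^sub>R axis a 1 + t *\<^sub>R axis b 1)) (pd b (pd a f) u) < ?e"
    using near[of s t a b] st h by (intro r2) auto
  moreover have "dist (pd a (pd b f) (u + s' *\<^sub>R axis b 1 + t' *\<^sub>R axis a 1)) (pd a (pd b f) u) < ?e"
    using near[of s' t' b a] st' h by (intro r1) auto
  ultimately show False by (auto simp: dist_real_def abs_if split: if_splits)
qed

text \<open>Membership in \<open>C\<^sup>k\<close> is a statement about all iterated partial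
  derivatives, so closure properties need a formula for these derivatives; such formulas hold only
  on the open set, and this lemma is what makes them usable in the inductions on \<open>k\<close>
  below.\<close>
lemma Ck_on_cong:
  assumes "open S" "Ck_on k S f" "\<And>u. u \<in> S \<Longrightarrow> h u = f u"
  shows "Ck_on k S h"
  using assms(2,3)
proof (induction k arbitrary: h f)
  case 0
  then show ?case by (simp cong: continuous_on_cong)
next
  case (Suc k)
  have "\<And>w. w \<in> S \<Longrightarrow> pd l h w = pd l f w" for l
    using Suc.prems by (intro pd_cong_open[OF \<open>open S\<close>]) auto
  moreover have "\<And>w. w \<in> S \<Longrightarrow> h differentiable at w"
    using differentiable_cong_open[OF \<open>open S\<close>, of _ h f] Ck_on_SucD(1)[OF Suc.prems(1) \<open>open S\<close>]
      Suc.prems(2) by blast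
  moreover have "Ck_on k S (pd l h)" for l
    using Suc.IH[of "pd l f" "pd l h"] Suc.prems(1) calculation(1) by simp
  ultimately show ?case
    by (simp add: differentiable_at_imp_differentiable_on)
qed

lemma Ck_on_vec_nth:
  assumes "open S" "Ck_on k S f"
  shows "Ck_on k S (\<lambda>v. f v $ i)"
  using assms(2)
proof (induction k arbitrary: f)
  case 0
  then show ?case by (simp add: bounded_linear.continuous_on[OF bounded_linear_vec_nth])
next
  case (Suc k)
  have d: "f differentiable at u" if "u \<in> S" for u
    using Ck_on_SucD(1)[OF Suc.prems \<open>open S\<close> that] .
  have "Ck_on k S (pd j (\<lambda>v. f v $ i))" for j
  proof (rule Ck_on_cong[OF \<open>open S\<close>])
    show "Ck_on k S (\<lambda>v. pd j f v $ i)"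
      using Suc.prems by (intro Suc.IH) simp
    show "pd j (\<lambda>v. f v $ i) u = pd j f u $ i" if "u \<in> S" for u
      by (rule pd_vec_nth[OF d[OF that]])
  qed
  then show ?case using d by (simp add: differentiable_at_imp_differentiable_on)
qed

lemma Ck_on_add:
  assumes "open S" "Ck_on k S f" "Ck_on k S h"
  shows "Ck_on k S (\<lambda>v. f v + h v)"
  using assms(2,3)
proof (induction k arbitrary: f h)
  case 0
  then show ?case by (simp add: continuous_on_add)
next
  case (Suc k)
  note d = Ck_on_SucD(1)[OF Suc.prems(1) \<open>open S\<close>] Ck_on_SucD(1)[OF Suc.prems(2) \<open>open S\<close>]
  have "Ck_on k S (pd i (\<lambda>v. f v + h v))" for i
  proof (rule Ck_on_cong[OF \<open>open S\<close>])
    show "Ck_on k S (\<lambda>v. pd i f v + pd i h v)"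
      using Suc.prems by (intro Suc.IH) simp_all
    show "pd i (\<lambda>v. f v + h v) u = pd i f u + pd i h u" if "u \<in> S" for u
      by (rule pd_add[OF d[OF that]])
  qed
  then show ?case using Suc.prems by (simp add: differentiable_on_add)
qed

lemma Ck_on_sum:
  assumes "open S" "\<And>j. j \<in> I \<Longrightarrow> Ck_on k S (f j)"
  shows "Ck_on k S (\<lambda>v. \<Sum>j\<in>I. f j v)"
  using assms(2)
  by (induction I rule: infinite_finite_induct) (simp_all add: Ck_on_add[OF \<open>open S\<close>])

lemma Ck_on_scaleR:
  assumes "open S" "Ck_on k S f" "Ck_on k S h"
  shows "Ck_on k S (\<lambda>v. f v *\<^sub>R h v)"
  using assms(2,3)
proof (induction k arbitrary: f h)
  case 0
  then show ?case by (simp add: continuous_on_scaleR)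
next
  case (Suc k)
  note d = Ck_on_SucD(1)[OF Suc.prems(1) \<open>open S\<close>] Ck_on_SucD(1)[OF Suc.prems(2) \<open>open S\<close>]
  have "Ck_on k S (pd i (\<lambda>v. f v *\<^sub>R h v))" for i
  proof (rule Ck_on_cong[OF \<open>open S\<close>])
    show "Ck_on k S (\<lambda>v. pd i f v *\<^sub>R h v + f v *\<^sub>R pd i h v)"
      using Suc.prems Ck_on_Suc_imp[OF \<open>open S\<close>, of k f] Ck_on_Suc_imp[OF \<open>open S\<close>, of k h]
      by (intro Ck_on_add[OF \<open>open S\<close>] Suc.IH) simp_all
    show "pd i (\<lambda>v. f v *\<^sub>R h v) u = pd i f u *\<^sub>R h u + f u *\<^sub>R pd i h u" if "u \<in> S" for u
      by (rule pd_scaleR[OF d[OF that]])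
  qed
  then show ?case using Suc.prems by (simp add: differentiable_on_scaleR)
qed

lemma pd_commute:
  fixes f :: "real^'d \<Rightarrow> real^'m"
  assumes C: "Ck_on 2 S f" and S: "open S" and u: "u \<in> S"
  shows "pd a (pd b f) u = pd b (pd a f) u"
proof -
  have d1: "f differentiable at w" if "w \<in> S" for w
    using Ck_on_2D(1)[OF C S that] .
  have d2: "pd a f differentiable at w" if "w \<in> S" for w a
    using Ck_on_2D(2)[OF C S that] .
  have "pd a (pd b f) u $ i = pd a (pd b (\<lambda>v. f v $ i)) u" for a b i
  proof -
    have "pd a (pd b f) u $ i = pd a (\<lambda>v. pd b f v $ i) u" using d2[OF u] by (simp add: pd_vec_nth)
    also have "\<dots> = pd a (pd b (\<lambda>v. f v $ i)) u"
      using d1 by (intro pd_cong_open[OF S u]) (simp add: pd_vec_nth)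
    finally show ?thesis .
  qed
  then show ?thesis
    using pd_commute_real[OF Ck_on_vec_nth[OF S C] S u, of a b] by (simp add: vec_eq_iff)
qed

section \<open>Covariant derivatives along a map and their curvature\<close>

text \<open>The Christoffel symbols as a bilinear map with values in vectors; in this form most
  computations avoid indices.\<close>
definition conn ::
  "(real^'m \<Rightarrow> 'm \<Rightarrow> 'm \<Rightarrow> 'm \<Rightarrow> real) \<Rightarrow> real^'m \<Rightarrow> real^'m \<Rightarrow> real^'m \<Rightarrow> real^'m" where
  "conn \<Gamma> p v w = (\<chi> i. \<Sum>j\<in>UNIV. \<Sum>k\<in>UNIV. \<Gamma> p i j k * v $ j * w $ k)"

text \<open>The derivative of the coefficients of \<open>conn\<close> in direction
  \<open>z\<close>.\<close>
definition dconn ::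
  "(real^'m \<Rightarrow> 'm \<Rightarrow> 'm \<Rightarrow> 'm \<Rightarrow> real) \<Rightarrow> real^'m \<Rightarrow> real^'m \<Rightarrow> real^'m \<Rightarrow> real^'m \<Rightarrow> real^'m" where
  "dconn \<Gamma> p z = conn (\<lambda>p i j k. \<Sum>l\<in>UNIV. z $ l * pd l (\<lambda>q. \<Gamma> q i j k) p) p"

definition cov ::
  "(real^'m \<Rightarrow> 'm \<Rightarrow> 'm \<Rightarrow> 'm \<Rightarrow> real) \<Rightarrow> (real^'n \<Rightarrow> real^'m) \<Rightarrow> 'n \<Rightarrow> (real^'n \<Rightarrow> real^'m) \<Rightarrow>
   real^'n \<Rightarrow> real^'m" where
  "cov \<Gamma> x a W u = pd a W u + conn \<Gamma> (x u) (pd a x u) (W u)"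

text \<open>The coordinate formula of the curvature operator \<open>R(z,v)y\<close>.\<close>
definition curv ::
  "(real^'m \<Rightarrow> 'm \<Rightarrow> 'm \<Rightarrow> 'm \<Rightarrow> real) \<Rightarrow> real^'m \<Rightarrow> real^'m \<Rightarrow> real^'m \<Rightarrow> real^'m \<Rightarrow> real^'m" where
  "curv \<Gamma> p z v y = dconn \<Gamma> p z v y - dconn \<Gamma> p v z y
     + conn \<Gamma> p z (conn \<Gamma> p v y) - conn \<Gamma> p v (conn \<Gamma> p z y)"

lemma conn_add_left: "conn \<Gamma> p (v + v') w = conn \<Gamma> p v w + conn \<Gamma> p v' w"
  by (simp add: conn_def vec_eq_iff algebra_simps sum.distrib)

lemma conn_add_right: "conn \<Gamma> p v (w + w') = conn \<Gamma> p v w + conn \<Gamma> p v w'"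
  by (simp add: conn_def vec_eq_iff algebra_simps sum.distrib)

lemma conn_scaleR_left: "conn \<Gamma> p (r *\<^sub>R v) w = r *\<^sub>R conn \<Gamma> p v w"
  by (simp add: conn_def vec_eq_iff algebra_simps sum_distrib_left)

lemma conn_scaleR_right: "conn \<Gamma> p v (r *\<^sub>R w) = r *\<^sub>R conn \<Gamma> p v w"
  by (simp add: conn_def vec_eq_iff algebra_simps sum_distrib_left)

lemma linear_conn_right: "linear (conn \<Gamma> p v)"
  by (intro linearI conn_add_right conn_scaleR_right)

lemma linear_conn_left: "linear (\<lambda>v. conn \<Gamma> p v w)"
  by (intro linearI conn_add_left conn_scaleR_left)

lemma conn_sum_right: "conn \<Gamma> p v (\<Sum>i\<in>I. f i) = (\<Sum>i\<in>I. conn \<Gamma> p v (f i))"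
  by (rule linear_sum[OF linear_conn_right])

lemma dconn_add:
  "dconn \<Gamma> p (z + z') v w = dconn \<Gamma> p z v w + dconn \<Gamma> p z' v w"
  by (simp add: conn_def dconn_def vec_eq_iff algebra_simps sum.distrib)

lemma dconn_scaleR: "dconn \<Gamma> p (r *\<^sub>R z) v w = r *\<^sub>R dconn \<Gamma> p z v w"
  by (simp add: conn_def dconn_def vec_eq_iff algebra_simps sum_distrib_left sum_distrib_right)

lemma linear_curv:
  "linear (\<lambda>z. curv \<Gamma> p z v y)" "linear (\<lambda>v. curv \<Gamma> p z v y)" "linear (\<lambda>y. curv \<Gamma> p z v y)"
proof -
  have d: "dconn \<Gamma> p z (v + v') y = dconn \<Gamma> p z v y + dconn \<Gamma> p z v' y"
    "dconn \<Gamma> p z v (y + y') = dconn \<Gamma> p z v y + dconn \<Gamma> p z v y'"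
    "dconn \<Gamma> p z (r *\<^sub>R v) y = r *\<^sub>R dconn \<Gamma> p z v y"
    "dconn \<Gamma> p z v (r *\<^sub>R y) = r *\<^sub>R dconn \<Gamma> p z v y" for z v v' y y' r
    by (simp_all add: dconn_def conn_add_left conn_add_right conn_scaleR_left conn_scaleR_right)
  show "linear (\<lambda>z. curv \<Gamma> p z v y)" "linear (\<lambda>v. curv \<Gamma> p z v y)" "linear (\<lambda>y. curv \<Gamma> p z v y)"
    by (auto intro!: linearI simp: curv_def d dconn_add dconn_scaleR algebra_simps
        conn_add_left conn_add_right conn_scaleR_left conn_scaleR_right)
qed

lemma differentiable_conn:
  fixes x A B :: "'d::real_normed_vector \<Rightarrow> real^'m"
  assumes "x differentiable at u" "\<And>i j k. (\<lambda>q. \<Gamma> q i j k) differentiable at (x u)"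
    and "A differentiable at u" "B differentiable at u"
  shows "(\<lambda>v. conn \<Gamma> (x v) (A v) (B v)) differentiable at u"
proof (rule differentiable_vec_lambda)
  fix i
  have "(\<lambda>v. \<Sum>j\<in>UNIV. \<Sum>k\<in>UNIV. \<Gamma> (x v) i j k * A v $ j * B v $ k) differentiable at u"
    using assms differentiable_chain[OF assms(1,2)] by (intro differentiable_trilinear)
  then show "(\<lambda>v. conn \<Gamma> (x v) (A v) (B v) $ i) differentiable at u" by (simp add: conn_def)
qed

lemma pd_conn:
  fixes x A B :: "real^'d \<Rightarrow> real^'m"
  assumes "x differentiable at u" "\<And>i j k. (\<lambda>q. \<Gamma> q i j k) differentiable at (x u)"
    and "A differentiable at u" "B differentiable at u"
  shows "pd c (\<lambda>v. conn \<Gamma> (x v) (A v) (B v)) u =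
    dconn \<Gamma> (x u) (pd c x u) (A u) (B u) + conn \<Gamma> (x u) (pd c A u) (B u) + conn \<Gamma> (x u) (A u) (pd c B u)"
proof (rule vec_eq_iff[THEN iffD2], rule allI)
  fix i
  have "pd c (\<lambda>v. conn \<Gamma> (x v) (A v) (B v)) u $ i
      = pd c (\<lambda>v. \<Sum>j\<in>UNIV. \<Sum>k\<in>UNIV. \<Gamma> (x v) i j k * A v $ j * B v $ k) u"
    by (simp add: differentiable_conn[OF assms] flip: pd_vec_nth) (simp add: conn_def)
  also have "\<dots> = (\<Sum>j\<in>UNIV. \<Sum>k\<in>UNIV. pd c (\<lambda>v. \<Gamma> (x v) i j k) u * A u $ j * B u $ k) +
    (\<Sum>j\<in>UNIV. \<Sum>k\<in>UNIV. \<Gamma> (x u) i j k * pd c A u $ j * B u $ k) +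
    (\<Sum>j\<in>UNIV. \<Sum>k\<in>UNIV. \<Gamma> (x u) i j k * A u $ j * pd c B u $ k)"
    using assms differentiable_chain[OF assms(1,2)] by (intro pd_trilinear)
  finally show "pd c (\<lambda>v. conn \<Gamma> (x v) (A v) (B v)) u $ i =
    (dconn \<Gamma> (x u) (pd c x u) (A u) (B u) + conn \<Gamma> (x u) (pd c A u) (B u)
      + conn \<Gamma> (x u) (A u) (pd c B u)) $ i"
    by (simp add: dconn_def conn_def pd_chain[OF assms(1,2)])
qed

lemma differentiable_cov:
  assumes "x differentiable at u" "\<And>i j k. (\<lambda>q. \<Gamma> q i j k) differentiable at (x u)"
    and "pd a x differentiable at u" "W differentiable at u" "pd a W differentiable at u"
  shows "cov \<Gamma> x a W differentiable at u"
proof -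
  have "cov \<Gamma> x a W = (\<lambda>v. pd a W v + conn \<Gamma> (x v) (pd a x v) (W v))"
    by (simp add: cov_def fun_eq_iff)
  then show ?thesis using assms by (simp add: differentiable_conn)
qed

text \<open>The second partial derivatives of \<open>W\<close> and of \<open>x\<close> cancel by
  symmetry, the first derivatives of \<open>W\<close> cancel because each occurs once in either
  order, and what remains is the expression \<open>curv\<close>.\<close>
proposition ricci_identity:
  fixes x W :: "real^'d \<Rightarrow> real^'m"
  assumes D: "open D" "u \<in> D" and C: "Ck_on 2 D x" "Ck_on 2 D W"
    and \<Gamma>: "\<And>i j k. (\<lambda>q. \<Gamma> q i j k) differentiable at (x u)"
  shows "cov \<Gamma> x c (cov \<Gamma> x d W) u - cov \<Gamma> x d (cov \<Gamma> x c W) u =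
    curv \<Gamma> (x u) (pd c x u) (pd d x u) (W u)"
proof -
  note diffs = Ck_on_2D[OF C(1) D] Ck_on_2D[OF C(2) D]
  have "cov \<Gamma> x c (cov \<Gamma> x d W) u = pd c (pd d W) u
     + (dconn \<Gamma> (x u) (pd c x u) (pd d x u) (W u) + conn \<Gamma> (x u) (pd c (pd d x) u) (W u)
        + conn \<Gamma> (x u) (pd d x u) (pd c W u))
     + (conn \<Gamma> (x u) (pd c x u) (pd d W u)
        + conn \<Gamma> (x u) (pd c x u) (conn \<Gamma> (x u) (pd d x u) (W u)))" for c d
  proof -
    have "pd c (cov \<Gamma> x d W) u = pd c (\<lambda>v. pd d W v + conn \<Gamma> (x v) (pd d x v) (W v)) u"
      by (simp add: cov_def[abs_def])
    also have "\<dots> = pd c (pd d W) u + pd c (\<lambda>v. conn \<Gamma> (x v) (pd d x v) (W v)) u"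
      using diffs \<Gamma> by (intro pd_add differentiable_conn)
    finally show ?thesis
      using diffs \<Gamma> by (simp add: cov_def[of _ _ c] pd_conn) (simp add: cov_def conn_add_right)
  qed
  then show ?thesis
    using pd_commute[OF C(1) D, of c d] pd_commute[OF C(2) D, of c d]
    by (simp add: curv_def)
qed

lemma cov_sum_scaleR:
  fixes f :: "'i::finite \<Rightarrow> real^'d \<Rightarrow> real"
  assumes "\<And>i. f i differentiable at u" "\<And>i. W i differentiable at u"
  shows "cov \<Gamma> x a (\<lambda>v. \<Sum>i\<in>UNIV. f i v *\<^sub>R W i v) u =
    (\<Sum>i\<in>UNIV. pd a (f i) u *\<^sub>R W i u + f i u *\<^sub>R cov \<Gamma> x a (W i) u)"
  using assms
  by (simp add: cov_def pd_sum pd_scaleR conn_sum_right conn_scaleR_right sum.distrib algebra_simps)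

lemma cov_cong_open:
  assumes "open S" "u \<in> S" "\<And>v. v \<in> S \<Longrightarrow> W v = W' v"
  shows "cov \<Gamma> x a W u = cov \<Gamma> x a W' u"
  using assms pd_cong_open[OF assms] by (simp add: cov_def)

lemma levi_civita_eq_cov:
  assumes "Y differentiable at p"
  shows "levi_civita G Z Y p = (\<Sum>j\<in>UNIV. Z p $ j *\<^sub>R cov (christoffel G) (\<lambda>q. q) j Y p)"
proof -
  have "(\<Sum>k\<in>UNIV. \<Sum>l\<in>UNIV. christoffel G p i k l * axis j 1 $ k * Y p $ l) =
      (\<Sum>l\<in>UNIV. christoffel G p i j l * Y p $ l)" for i j
  proof -
    have "(\<Sum>k\<in>UNIV. \<Sum>l\<in>UNIV. christoffel G p i k l * axis j 1 $ k * Y p $ l) =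
      (\<Sum>k\<in>UNIV. if k = j then \<Sum>l\<in>UNIV. christoffel G p i k l * Y p $ l else 0)"
      by (intro sum.cong) (auto simp: axis_def)
    then show ?thesis by simp
  qed
  then show ?thesis
    using assms by (simp add: levi_civita_def cov_def vec_eq_iff pd_vec_nth conn_def)
qed

text \<open>The first derivatives of \<open>V\<close> and \<open>Z\<close> in the two second
  derivatives are exactly those of the Lie bracket. Differentiability of \<open>\<nabla>\<^sub>j
  Y\<close> is a hypothesis, rather than differentiability of the Christoffel symbols, because for
  the induced metric it is the former that the Gauss formula provides.\<close>
lemma curvature_op_eq_commutator:
  fixes G :: "real^'d \<Rightarrow> real^'d^'d" and Y Z V :: "real^'d \<Rightarrow> real^'d"
  defines "C \<equiv> cov (christoffel G) (\<lambda>q. q)"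
  assumes S: "open S" "p \<in> S" and Y: "\<And>q. q \<in> S \<Longrightarrow> Y differentiable at q"
    and ZV: "Z differentiable at p" "V differentiable at p"
    and CY: "\<And>j. C j Y differentiable at p"
  shows "curvature_op G Z V Y p =
    (\<Sum>k\<in>UNIV. \<Sum>j\<in>UNIV. (Z p $ k * V p $ j) *\<^sub>R (C k (C j Y) p - C j (C k Y) p))"
proof -
  have LC: "levi_civita G A (levi_civita G B Y) p =
      (\<Sum>k\<in>UNIV. \<Sum>j\<in>UNIV. (A p $ k * pd k B p $ j) *\<^sub>R C j Y p + (A p $ k * B p $ j) *\<^sub>R C k (C j Y) p)"
    if "B differentiable at p" for A B
  proof -
    let ?W = "\<lambda>q. \<Sum>j\<in>UNIV. B q $ j *\<^sub>R C j Y q"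
    have eq: "levi_civita G B Y q = ?W q" if "q \<in> S" for q
      using levi_civita_eq_cov[OF Y[OF that]] by (simp add: C_def)
    have W: "?W differentiable at p"
      using CY that by (intro differentiable_sum' differentiable_scaleR) auto
    have "levi_civita G B Y differentiable at p"
      using differentiable_cong_open[OF S eq W] .
    then have "levi_civita G A (levi_civita G B Y) p =
        (\<Sum>k\<in>UNIV. A p $ k *\<^sub>R C k (levi_civita G B Y) p)"
      by (simp add: levi_civita_eq_cov C_def)
    also have "\<dots> = (\<Sum>k\<in>UNIV. A p $ k *\<^sub>R C k ?W p)"
      unfolding C_def using cov_cong_open[OF S eq] by (simp add: C_def)
    also have "\<dots> = (\<Sum>k\<in>UNIV. A p $ k *\<^sub>R
        (\<Sum>j\<in>UNIV. pd k B p $ j *\<^sub>R C j Y p + B p $ j *\<^sub>R C k (C j Y) p))"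
      using that CY unfolding C_def by (simp add: cov_sum_scaleR pd_vec_nth)
    finally show ?thesis by (simp add: scaleR_sum_right algebra_simps)
  qed
  have "levi_civita G (lie_bracket Z V) Y p =
      (\<Sum>j\<in>UNIV. \<Sum>k\<in>UNIV. (Z p $ k * pd k V p $ j - V p $ k * pd k Z p $ j) *\<^sub>R C j Y p)"
    using ZV Y[OF S(2)]
    by (simp add: levi_civita_eq_cov lie_bracket_def pd_vec_nth C_def scaleR_sum_left)
  also have "\<dots> = (\<Sum>k\<in>UNIV. \<Sum>j\<in>UNIV. (Z p $ k * pd k V p $ j - V p $ k * pd k Z p $ j) *\<^sub>R C j Y p)"
    by (rule sum.swap)
  finally have LB: "levi_civita G (lie_bracket Z V) Y p = \<dots>" .
  have swap: "(\<Sum>k\<in>UNIV. \<Sum>j\<in>UNIV. (V p $ k * Z p $ j) *\<^sub>R C k (C j Y) p) =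
      (\<Sum>k\<in>UNIV. \<Sum>j\<in>UNIV. (Z p $ k * V p $ j) *\<^sub>R C j (C k Y) p)"
    by (subst sum.swap) (simp add: mult.commute)
  show ?thesis
    unfolding curvature_op_def LB LC[OF ZV(1)] LC[OF ZV(2)]
    by (simp add: sum.distrib sum_subtractf swap scaleR_diff_left scaleR_diff_right)
qed

text \<open>The Ricci identity for the identity map.\<close>
lemma curvature_op_eq_curv:
  assumes S: "open S" "p \<in> S" and Y: "Ck_on 2 S Y"
    and ZV: "Z differentiable at p" "V differentiable at p"
    and \<Gamma>: "\<And>i j k. (\<lambda>q. christoffel G q i j k) differentiable at p"
  shows "curvature_op G Z V Y p = curv (christoffel G) p (Z p) (V p) (Y p)"
proof -
  let ?C = "cov (christoffel G) (\<lambda>q. q)"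
  have "?C j Y differentiable at p" for j
    using Ck_on_2D[OF Y S] \<Gamma> by (intro differentiable_cov) (auto simp: pd_id[abs_def])
  then have "curvature_op G Z V Y p =
      (\<Sum>k\<in>UNIV. \<Sum>j\<in>UNIV. (Z p $ k * V p $ j) *\<^sub>R (?C k (?C j Y) p - ?C j (?C k Y) p))"
    using Ck_on_2D(1)[OF Y S(1)] ZV by (intro curvature_op_eq_commutator[OF S])
  also have "\<dots> = (\<Sum>k\<in>UNIV. \<Sum>j\<in>UNIV. (Z p $ k * V p $ j) *\<^sub>R
      curv (christoffel G) p (axis k 1) (axis j 1) (Y p))"
    using ricci_identity[OF S Ck_on_id Y, of "christoffel G"] \<Gamma> by simp
  also have "\<dots> = (\<Sum>k\<in>UNIV. Z p $ k *\<^sub>R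
      curv (christoffel G) p (axis k 1) (\<Sum>j\<in>UNIV. V p $ j *\<^sub>R axis j 1) (Y p))"
    by (simp add: linear_sum[OF linear_curv(2)] linear_scale[OF linear_curv(2)] scaleR_sum_right)
  also have "\<dots> = curv (christoffel G) p (\<Sum>k\<in>UNIV. Z p $ k *\<^sub>R axis k 1)
      (\<Sum>j\<in>UNIV. V p $ j *\<^sub>R axis j 1) (Y p)"
    by (simp add: linear_sum[OF linear_curv(1)] linear_scale[OF linear_curv(1)])
  finally show ?thesis by (simp add: basis_expansion flip: scalar_mult_eq_scaleR)
qed


section \<open>Curvature tensors and their components\<close>

lemma met_add_left: "met G p (v + v') w = met G p v w + met G p v' w"
  by (simp add: met_def algebra_simps sum.distrib)

lemma met_add_right: "met G p v (w + w') = met G p v w + met G p v w'"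
  by (simp add: met_def algebra_simps sum.distrib)

lemma met_scaleR_left: "met G p (r *\<^sub>R v) w = r * met G p v w"
  by (simp add: met_def algebra_simps sum_distrib_left)

lemma met_scaleR_right: "met G p v (r *\<^sub>R w) = r * met G p v w"
  by (simp add: met_def algebra_simps sum_distrib_left)

lemma linear_met_left: "linear (\<lambda>v. met G p v w)"
  by (intro linearI) (simp_all add: met_add_left met_scaleR_left)

lemma linear_met_right: "linear (met G p v)"
  by (intro linearI) (simp_all add: met_add_right met_scaleR_right)

lemmas met_sum_left = linear_sum[OF linear_met_left]
lemmas met_sum_right = linear_sum[OF linear_met_right]
lemmas met_diff_left = linear_diff[OF linear_met_left]
lemmas met_diff_right = linear_diff[OF linear_met_right]

lemma met_axis: "met G p (axis i 1) (axis j 1) = G p $ i $ j"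
proof -
  have "met G p (axis i 1) (axis j 1)
      = (\<Sum>k\<in>UNIV. if k = i then \<Sum>l\<in>UNIV. if l = j then G p $ k $ l else 0 else 0)"
    unfolding met_def by (intro sum.cong refl) (simp add: axis_def mult_delta_right)
  then show ?thesis by simp
qed

lemma linear_expand:
  fixes f :: "real^'m \<Rightarrow> real"
  assumes "linear f"
  shows "f v = (\<Sum>i\<in>UNIV. v $ i * f (axis i 1))"
proof -
  have "f v = f (\<Sum>i\<in>UNIV. v $ i *\<^sub>R axis i 1)"
    by (simp add: basis_expansion flip: scalar_mult_eq_scaleR)
  then show ?thesis by (simp add: linear_sum[OF assms] linear_scale[OF assms])
qed

text \<open>Turns an index sum against the components of a tensor into the value of the
  tensor.\<close>
lemma multilinear_expand:
  fixes F :: "real^'m \<Rightarrow> real^'m \<Rightarrow> real^'m \<Rightarrow> real^'m \<Rightarrow> real"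
  assumes "\<And>Y Z V. linear (\<lambda>X. F X Y Z V)" "\<And>X Z V. linear (\<lambda>Y. F X Y Z V)"
    "\<And>X Y V. linear (\<lambda>Z. F X Y Z V)" "\<And>X Y Z. linear (\<lambda>V. F X Y Z V)"
  shows "F X Y Z V = (\<Sum>i\<in>UNIV. \<Sum>j\<in>UNIV. \<Sum>k\<in>UNIV. \<Sum>l\<in>UNIV.
    F (axis i 1) (axis j 1) (axis k 1) (axis l 1) * X $ i * Y $ j * Z $ k * V $ l)"
proof -
  have "F X Y Z V = (\<Sum>i\<in>UNIV. X $ i * F (axis i 1) Y Z V)"
    by (rule linear_expand[OF assms(1)])
  also have "\<dots> = (\<Sum>i\<in>UNIV. X $ i * (\<Sum>j\<in>UNIV. Y $ j * F (axis i 1) (axis j 1) Z V))"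
    by (intro sum.cong refl arg_cong2[where f = "(*)"] linear_expand[OF assms(2)])
  also have "\<dots> = (\<Sum>i\<in>UNIV. X $ i * (\<Sum>j\<in>UNIV. Y $ j * (\<Sum>k\<in>UNIV. Z $ k *
      F (axis i 1) (axis j 1) (axis k 1) V)))"
    by (intro sum.cong refl arg_cong2[where f = "(*)"] linear_expand[OF assms(3)])
  also have "\<dots> = (\<Sum>i\<in>UNIV. X $ i * (\<Sum>j\<in>UNIV. Y $ j * (\<Sum>k\<in>UNIV. Z $ k *
      (\<Sum>l\<in>UNIV. V $ l * F (axis i 1) (axis j 1) (axis k 1) (axis l 1)))))"
    by (intro sum.cong refl arg_cong2[where f = "(*)"] linear_expand[OF assms(4)])
  finally show ?thesis by (simp add: sum_distrib_left mult_ac)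
qed

lemma riem_at_eq_curv:
  assumes "\<And>i j k. (\<lambda>q. christoffel G q i j k) differentiable at p"
  shows "riem_at G p X Y Z V = met G p (curv (christoffel G) p Z V Y) X"
proof -
  have "riem_comp G p i j k l =
      met G p (curv (christoffel G) p (axis k 1) (axis l 1) (axis j 1)) (axis i 1)" for i j k l
    using curvature_op_eq_curv[of UNIV p "\<lambda>_. axis j 1" "\<lambda>_. axis k 1" "\<lambda>_. axis l 1" G] assms
    by (simp add: riem_comp_def riem_def)
  moreover have "linear (\<lambda>z. met G p (curv (christoffel G) p z v y) x)"
    "linear (\<lambda>v. met G p (curv (christoffel G) p z v y) x)"
    "linear (\<lambda>y. met G p (curv (christoffel G) p z v y) x)"
    "linear (\<lambda>x. met G p (curv (christoffel G) p z v y) x)" for z v y x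
    using linear_curv[of "christoffel G" p]
    by (auto simp: linear_met_right intro!: linearI simp: met_add_left met_scaleR_left
        linear_add[OF linear_curv(1)] linear_add[OF linear_curv(2)] linear_add[OF linear_curv(3)]
        linear_scale[OF linear_curv(1)] linear_scale[OF linear_curv(2)] linear_scale[OF linear_curv(3)]
        met_add_right met_scaleR_right)
  ultimately show ?thesis
    unfolding riem_at_def
    by (subst multilinear_expand[of "\<lambda>X Y Z V. met G p (curv (christoffel G) p Z V Y) X"]) simp_all
qed

section \<open>The Levi-Civita connection of a metric in coordinates\<close>

lemma sum_swap_1_3:
  "(\<Sum>i\<in>A. \<Sum>j\<in>B. \<Sum>k\<in>C. f i j k :: 'b::comm_monoid_add) = (\<Sum>k\<in>C. \<Sum>j\<in>B. \<Sum>i\<in>A. f i j k)"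
proof -
  have "(\<Sum>i\<in>A. \<Sum>j\<in>B. \<Sum>k\<in>C. f i j k) = (\<Sum>i\<in>A. \<Sum>k\<in>C. \<Sum>j\<in>B. f i j k)"
    by (intro sum.cong refl sum.swap)
  also have "\<dots> = (\<Sum>k\<in>C. \<Sum>i\<in>A. \<Sum>j\<in>B. f i j k)" by (rule sum.swap)
  also have "\<dots> = (\<Sum>k\<in>C. \<Sum>j\<in>B. \<Sum>i\<in>A. f i j k)" by (intro sum.cong refl sum.swap)
  finally show ?thesis .
qed

lemma sum_swap_1_4:
  "(\<Sum>i\<in>A. \<Sum>j\<in>B. \<Sum>k\<in>C. \<Sum>l\<in>D. f i j k l :: 'b::comm_monoid_add) =
    (\<Sum>l\<in>D. \<Sum>j\<in>B. \<Sum>k\<in>C. \<Sum>i\<in>A. f i j k l)"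
proof -
  have "(\<Sum>i\<in>A. \<Sum>j\<in>B. \<Sum>k\<in>C. \<Sum>l\<in>D. f i j k l) = (\<Sum>i\<in>A. \<Sum>l\<in>D. \<Sum>k\<in>C. \<Sum>j\<in>B. f i j k l)"
    by (intro sum.cong refl sum_swap_1_3)
  also have "\<dots> = (\<Sum>l\<in>D. \<Sum>i\<in>A. \<Sum>k\<in>C. \<Sum>j\<in>B. f i j k l)" by (rule sum.swap)
  also have "\<dots> = (\<Sum>l\<in>D. \<Sum>j\<in>B. \<Sum>k\<in>C. \<Sum>i\<in>A. f i j k l)" by (intro sum.cong refl sum_swap_1_3)
  finally show ?thesis .
qed

lemma met_eq_inner: "met G p v w = v \<bullet> (G p *v w)"
  by (simp add: met_def inner_vec_def matrix_vector_mult_def sum_distrib_left mult_ac)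

lemma differentiable_det:
  fixes A :: "'d::real_normed_vector \<Rightarrow> real^'n^'n"
  assumes "\<And>i j. (\<lambda>q. A q $ i $ j) differentiable at p"
  shows "(\<lambda>q. det (A q)) differentiable at p"
proof -
  have "(\<lambda>q. \<Prod>i\<in>I. f i q :: real) differentiable at p"
    if "\<And>i. f i differentiable at p" for I and f :: "'n \<Rightarrow> 'd \<Rightarrow> real"
    using that by (induction I rule: infinite_finite_induct) auto
  then show ?thesis
    using assms unfolding det_def by (intro differentiable_sum' differentiable_mult) auto
qed

text \<open>This is used for the ambient metric on a chart domain and for the induced metric on a
  domain of the submanifold. Differentiability is required componentwise, since this is what is at
  hand for the induced metric.\<close>
locale coordinate_metric =
  fixes U :: "(real^'d) set" and G :: "real^'d \<Rightarrow> real^'d^'d"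
  assumes open_dom: "open U"
    and differentiable_G: "\<And>q i j. q \<in> U \<Longrightarrow> (\<lambda>q. G q $ i $ j) differentiable at q"
    and G_commute: "\<And>q i j. q \<in> U \<Longrightarrow> G q $ i $ j = G q $ j $ i"
    and G_pos: "\<And>q v. q \<in> U \<Longrightarrow> v \<noteq> 0 \<Longrightarrow> 0 < met G q v v"
begin

lemma met_commute:
  assumes "q \<in> U" shows "met G q v w = met G q w v"
proof -
  have "met G q v w = (\<Sum>i\<in>UNIV. \<Sum>j\<in>UNIV. G q $ j $ i * v $ i * w $ j)"
    unfolding met_def by (intro sum.cong refl) (simp add: G_commute[OF assms])
  also have "\<dots> = met G q w v"
    by (subst sum.swap) (simp add: met_def mult_ac)
  finally show ?thesis .
qed

lemma met_nondegenerate: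
  assumes "q \<in> U" "\<And>w. met G q v w = met G q v' w"
  shows "v = v'"
proof (rule ccontr)
  assume "v \<noteq> v'"
  then have "0 < met G q (v - v') (v - v')" using G_pos[OF assms(1)] by simp
  then show False using assms(2) by (simp add: met_diff_left)
qed

lemma invertible_G:
  assumes "q \<in> U" shows "invertible (G q)"
proof -
  have "v = 0" if "G q *v v = 0" for v
    using G_pos[OF assms, of v] that by (auto simp: met_eq_inner)
  then show ?thesis
    by (simp add: invertible_left_inverse matrix_left_invertible_ker)
qed

lemma upper_mult_G:
  assumes "q \<in> U"
  shows "(\<Sum>k\<in>UNIV. upper G q i k * G q $ k $ j) = (if i = j then 1 else 0)"
    and "(\<Sum>k\<in>UNIV. G q $ i $ k * upper G q k j) = (if i = j then 1 else 0)"
proof -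
  have "(matrix_inv (G q) ** G q) $ i $ j = mat 1 $ i $ j"
    "(G q ** matrix_inv (G q)) $ i $ j = mat 1 $ i $ j"
    using someI_ex[OF invertible_G[OF assms, unfolded invertible_def]]
    by (simp_all add: matrix_inv_def)
  then show "(\<Sum>k\<in>UNIV. upper G q i k * G q $ k $ j) = (if i = j then 1 else 0)"
    "(\<Sum>k\<in>UNIV. G q $ i $ k * upper G q k j) = (if i = j then 1 else 0)"
    by (simp_all add: upper_def matrix_matrix_mult_def mat_def)
qed

text \<open>Cramer's rule; it exhibits the inverse metric as a quotient of polynomials in the
  metric, which is how its differentiability is obtained.\<close>
lemma upper_eq_cramer:
  assumes "q \<in> U"
  shows "upper G q i j =
    det (\<chi> r s. if s = i then axis j 1 $ r else G q $ r $ s) / det (G q)"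
proof -
  have "G q *v (\<chi> k. upper G q k j) = axis j 1"
    using upper_mult_G(2)[OF assms, of _ j]
    by (simp add: vec_eq_iff matrix_vector_mult_def axis_def)
  then have "(\<chi> k. upper G q k j) =
      (\<chi> k. det (\<chi> r s. if s = k then axis j 1 $ r else G q $ r $ s) / det (G q))"
    using cramer[of "G q" "\<chi> k. upper G q k j" "axis j 1"] invertible_G[OF assms]
    by (simp add: invertible_det_nz)
  then show ?thesis by (simp add: vec_eq_iff)
qed

lemma differentiable_upper:
  assumes "q \<in> U"
  shows "(\<lambda>q. upper G q i j) differentiable at q"
proof (rule differentiable_cong_open[OF open_dom assms upper_eq_cramer])
  have "(\<lambda>q. (\<chi> r s. if s = i then axis j 1 $ r else G q $ r $ s) $ r $ s) differentiable at q" for r s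
    using differentiable_G[OF assms] by (cases "s = i") simp_all
  then have "(\<lambda>q. det (\<chi> r s. if s = i then axis j 1 $ r else G q $ r $ s)) differentiable at q"
    by (rule differentiable_det)
  moreover have "(\<lambda>q. det (G q)) differentiable at q"
    by (rule differentiable_det) (rule differentiable_G[OF assms])
  ultimately show "(\<lambda>q. det (\<chi> r s. if s = i then axis j 1 $ r else G q $ r $ s) / det (G q))
      differentiable at q"
    using invertible_G[OF assms] by (intro differentiable_divide) (auto simp: invertible_det_nz)
qed

lemma pd_G_commute:
  assumes "q \<in> U"
  shows "pd l (\<lambda>q. G q $ i $ j) q = pd l (\<lambda>q. G q $ j $ i) q"
  by (rule pd_cong_open[OF open_dom assms G_commute])

lemma christoffel_commute:
  assumes "q \<in> U"
  shows "christoffel G q i j k = christoffel G q i k j"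
  unfolding christoffel_def using pd_G_commute[OF assms, of _ j k] by (simp add: add.commute)

lemma conn_commute:
  assumes "q \<in> U"
  shows "conn (christoffel G) q v w = conn (christoffel G) q w v"
proof (rule vec_eq_iff[THEN iffD2], rule allI)
  fix i
  have "conn (christoffel G) q v w $ i = (\<Sum>j\<in>UNIV. \<Sum>k\<in>UNIV. christoffel G q i k j * v $ j * w $ k)"
    unfolding conn_def using christoffel_commute[OF assms] by simp
  also have "\<dots> = conn (christoffel G) q w v $ i"
    by (subst sum.swap) (simp add: conn_def mult_ac)
  finally show "conn (christoffel G) q v w $ i = conn (christoffel G) q w v $ i" .
qed

text \<open>Lowering the upper index removes the inverse metric from the definition of the
  Christoffel symbols.\<close>
lemma christoffel_lower:
  assumes "q \<in> U"
  shows "(\<Sum>h\<in>UNIV. G q $ b $ h * christoffel G q h c a) =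
    (pd c (\<lambda>q. G q $ a $ b) q + pd a (\<lambda>q. G q $ c $ b) q - pd b (\<lambda>q. G q $ c $ a) q) / 2"
proof -
  let ?K = "\<lambda>l. pd c (\<lambda>q. G q $ a $ l) q + pd a (\<lambda>q. G q $ c $ l) q - pd l (\<lambda>q. G q $ c $ a) q"
  have "(\<Sum>h\<in>UNIV. G q $ b $ h * christoffel G q h c a)
      = (\<Sum>h\<in>UNIV. \<Sum>l\<in>UNIV. G q $ b $ h * upper G q h l * (?K l / 2))"
    by (simp add: christoffel_def sum_distrib_left mult_ac)
  also have "\<dots> = (\<Sum>l\<in>UNIV. (\<Sum>h\<in>UNIV. G q $ b $ h * upper G q h l) * (?K l / 2))"
    by (subst sum.swap) (simp only: sum_distrib_right)
  also have "\<dots> = (\<Sum>l\<in>UNIV. if l = b then ?K l / 2 else 0)"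
    by (intro sum.cong refl) (simp add: upper_mult_G(2)[OF assms])
  finally show ?thesis by simp
qed

lemma metric_compatible:
  assumes "q \<in> U"
  shows "pd l (\<lambda>q. G q $ i $ j) q =
    (\<Sum>h\<in>UNIV. G q $ h $ j * christoffel G q h l i) + (\<Sum>h\<in>UNIV. G q $ i $ h * christoffel G q h l j)"
proof -
  have "(\<Sum>h\<in>UNIV. G q $ h $ j * christoffel G q h l i) = (\<Sum>h\<in>UNIV. G q $ j $ h * christoffel G q h l i)"
    by (intro sum.cong refl) (simp add: G_commute[OF assms])
  then show ?thesis
    using christoffel_lower[OF assms] pd_G_commute[OF assms, of _ i j] pd_G_commute[OF assms, of _ l i]
      pd_G_commute[OF assms, of _ l j]
    by (simp add: add_divide_distrib diff_divide_distrib)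
qed

lemma differentiable_christoffel:
  assumes "q \<in> U" "\<And>i j k. (\<lambda>q. pd k (\<lambda>q. G q $ i $ j) q) differentiable at q"
  shows "(\<lambda>q. christoffel G q i j k) differentiable at q"
  unfolding christoffel_def
  using assms(2) differentiable_upper[OF assms(1)]
  by (intro differentiable_mult differentiable_sum' differentiable_add differentiable_diff) auto

lemma differentiable_met:
  fixes x A B :: "'e::real_normed_vector \<Rightarrow> real^'d"
  assumes "x differentiable at u" "x u \<in> U" "A differentiable at u" "B differentiable at u"
  shows "(\<lambda>v. met G (x v) (A v) (B v)) differentiable at u"
  unfolding met_def
  by (intro differentiable_trilinear differentiable_chain[OF assms(1) differentiable_G] assms)

text \<open>Metric compatibility of the connection, pulled back along a map.\<close>
lemma pd_met:
  fixes x A B :: "real^'e \<Rightarrow> real^'d"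
  assumes "x differentiable at u" "x u \<in> U" "A differentiable at u" "B differentiable at u"
  shows "pd c (\<lambda>v. met G (x v) (A v) (B v)) u =
    met G (x u) (cov (christoffel G) x c A u) (B u) + met G (x u) (A u) (cov (christoffel G) x c B u)"
proof -
  let ?e = "pd c x u" and ?\<Gamma> = "christoffel G (x u)" and ?A = "A u" and ?B = "B u" and ?G = "G (x u)"
  have "pd c (\<lambda>v. met G (x v) (A v) (B v)) u =
    (\<Sum>i\<in>UNIV. \<Sum>j\<in>UNIV. pd c (\<lambda>v. G (x v) $ i $ j) u * ?A $ i * ?B $ j) +
    met G (x u) (pd c A u) (?B) + met G (x u) ?A (pd c B u)"
    unfolding met_def
    by (intro pd_trilinear differentiable_chain[OF assms(1) differentiable_G] assms)
  moreover have "(\<Sum>i\<in>UNIV. \<Sum>j\<in>UNIV. pd c (\<lambda>v. G (x v) $ i $ j) u * ?A $ i * ?B $ j) =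
      (\<Sum>i\<in>UNIV. \<Sum>j\<in>UNIV. \<Sum>l\<in>UNIV. \<Sum>h\<in>UNIV. ?e $ l * (?G $ h $ j * ?\<Gamma> h l i) * ?A $ i * ?B $ j) +
      (\<Sum>i\<in>UNIV. \<Sum>j\<in>UNIV. \<Sum>l\<in>UNIV. \<Sum>h\<in>UNIV. ?e $ l * (?G $ i $ h * ?\<Gamma> h l j) * ?A $ i * ?B $ j)"
    by (simp add: pd_chain[OF assms(1) differentiable_G[OF assms(2)]] metric_compatible[OF assms(2)]
        sum.distrib sum_distrib_left sum_distrib_right distrib_left distrib_right)
  moreover have "met G (x u) (conn (christoffel G) (x u) ?e ?A) ?B =
      (\<Sum>h\<in>UNIV. \<Sum>j\<in>UNIV. \<Sum>l\<in>UNIV. \<Sum>i\<in>UNIV. ?e $ l * (?G $ h $ j * ?\<Gamma> h l i) * ?A $ i * ?B $ j)"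
    by (simp add: met_def conn_def sum_distrib_left sum_distrib_right mult_ac)
  moreover have "met G (x u) ?A (conn (christoffel G) (x u) ?e ?B) =
      (\<Sum>i\<in>UNIV. \<Sum>h\<in>UNIV. \<Sum>l\<in>UNIV. \<Sum>j\<in>UNIV. ?e $ l * (?G $ i $ h * ?\<Gamma> h l j) * ?A $ i * ?B $ j)"
    by (simp add: met_def conn_def sum_distrib_left sum_distrib_right mult_ac)
  moreover note sum_swap_1_4[of "\<lambda>i j l h. ?e $ l * (?G $ h $ j * ?\<Gamma> h l i) * ?A $ i * ?B $ j" UNIV UNIV UNIV UNIV]
  moreover have "(\<Sum>i\<in>UNIV. \<Sum>j\<in>UNIV. \<Sum>l\<in>UNIV. \<Sum>h\<in>UNIV. ?e $ l * (?G $ i $ h * ?\<Gamma> h l j) * ?A $ i * ?B $ j)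
    = (\<Sum>i\<in>UNIV. \<Sum>h\<in>UNIV. \<Sum>l\<in>UNIV. \<Sum>j\<in>UNIV. ?e $ l * (?G $ i $ h * ?\<Gamma> h l j) * ?A $ i * ?B $ j)"
    by (intro sum.cong refl sum_swap_1_3)
  ultimately show ?thesis
    by (simp add: cov_def met_add_left met_add_right)
qed

end

section \<open>Submanifolds and the Gauss equation\<close>

text \<open>The differential of \<open>x\<close> at \<open>u\<close>, written through the coordinate
  tangent vectors; it is the inclusion of \<open>T\<Sigma>\<close> into \<open>TM\<close>.\<close>
definition tangent :: "(real^'n \<Rightarrow> real^'m) \<Rightarrow> real^'n \<Rightarrow> real^'n \<Rightarrow> real^'m" where
  "tangent x u w = (\<Sum>a\<in>UNIV. w $ a *\<^sub>R pd a x u)"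

lemma tangent_axis [simp]: "tangent x u (axis a 1) = pd a x u"
proof -
  have "tangent x u (axis a 1) = (\<Sum>b\<in>UNIV. if b = a then pd b x u else 0)"
    unfolding tangent_def by (intro sum.cong refl) (simp add: axis_def)
  then show ?thesis by simp
qed

lemma linear_tangent: "linear (tangent x u)"
  by (intro linearI)
    (simp_all add: tangent_def scaleR_add_left sum.distrib scaleR_sum_right)

text \<open>The coordinate data that the Gauss equation depends on. One derivative of
  \<open>x\<close> is used by the metric, and the curvature takes two more.\<close>
locale coordinate_submanifold = coordinate_metric U G
  for U :: "(real^'m) set" and G :: "real^'m \<Rightarrow> real^'m^'m" +
  fixes D :: "(real^'n) set" and x :: "real^'n \<Rightarrow> real^'m"
  assumes open_D: "open D" and G_C2: "Ck_on 2 U G" and x_C3: "Ck_on 3 D x"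
    and x_in: "\<And>u. u \<in> D \<Longrightarrow> x u \<in> U"
    and x_immersion: "\<And>u. u \<in> D \<Longrightarrow> inj (frechet_derivative x (at u))"
begin

abbreviation "g \<equiv> induced_metric G x"
abbreviation "\<Gamma> \<equiv> christoffel G"
abbreviation "ip u \<equiv> met G (x u)"

lemma x_C2: "Ck_on 2 D x"
  using Ck_on_Suc_imp[OF open_D, of 2 x] x_C3 by (simp add: numeral_3_eq_3 numeral_2_eq_2)

lemma pd_x_C2: "Ck_on 2 D (pd a x)"
  using x_C3 by (simp add: numeral_3_eq_3 numeral_2_eq_2)

lemmas differentiable_x = Ck_on_2D[OF x_C2 open_D]

lemma differentiable_\<Gamma>:
  assumes "q \<in> U" shows "(\<lambda>q. \<Gamma> q i j k) differentiable at q"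
proof (rule differentiable_christoffel[OF assms])
  fix i j k
  have C: "Ck_on 2 U (\<lambda>q. G q $ i)" by (rule Ck_on_vec_nth[OF open_dom G_C2])
  have "Ck_on 2 U (\<lambda>q. G q $ i $ j)" by (rule Ck_on_vec_nth[OF open_dom C])
  from Ck_on_2D(2)[OF this open_dom assms]
  show "(\<lambda>q. pd k (\<lambda>q. G q $ i $ j) q) differentiable at q" .
qed

lemma induced_metric_nth [simp]: "g u $ a $ b = ip u (pd a x u) (pd b x u)"
  by (simp add: induced_metric_def)

lemma met_tangent: "ip u (tangent x u v) (tangent x u w) = met g u v w"
  by (simp only: tangent_def[of _ _ v] met_sum_left met_scaleR_left)
    (simp add: tangent_def met_def[of g] met_sum_right met_scaleR_right sum_distrib_left mult_ac)

lemma differentiable_ip: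
  assumes "u \<in> D" "A differentiable at u" "B differentiable at u"
  shows "(\<lambda>v. ip v (A v) (B v)) differentiable at u"
  using assms by (intro differentiable_met differentiable_x x_in)

lemma pd_ip:
  assumes "u \<in> D" "A differentiable at u" "B differentiable at u"
  shows "pd c (\<lambda>v. ip v (A v) (B v)) u = ip u (cov \<Gamma> x c A u) (B u) + ip u (A u) (cov \<Gamma> x c B u)"
  using assms by (intro pd_met differentiable_x x_in)

sublocale S: coordinate_metric D g
proof
  fix u assume u: "u \<in> D"
  show "(\<lambda>q. g q $ a $ b) differentiable at u" for a b
    using u by (simp add: differentiable_ip differentiable_x)
  show "g u $ a $ b = g u $ b $ a" for a b
    using met_commute[OF x_in[OF u]] by simp
  fix v :: "real^'n" assume "v \<noteq> 0"
  have "frechet_derivative x (at u) v = tangent x u v"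
    using frechet_derivative_eq_sum_pd[OF differentiable_x(1)[OF u]] by (simp add: tangent_def)
  moreover have "frechet_derivative x (at u) v \<noteq> 0"
    using x_immersion[OF u] \<open>v \<noteq> 0\<close> linear_frechet_derivative[OF differentiable_x(1)[OF u]]
    by (metis injD linear_0)
  ultimately show "0 < met g u v v"
    using G_pos[OF x_in[OF u]] by (simp flip: met_tangent)
qed (rule open_D)

text \<open>The partial derivatives of \<open>x\<close> commute and the connection is free of
  torsion.\<close>
lemma cov_pd_commute:
  assumes "u \<in> D"
  shows "cov \<Gamma> x a (pd b x) u = cov \<Gamma> x b (pd a x) u"
  using pd_commute[OF x_C2 open_D assms, of a b] conn_commute[OF x_in[OF assms]]
  by (simp add: cov_def)

text \<open>The right-hand side is symmetric in \<open>c\<close> and \<open>a\<close> and, by metric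
  compatibility, its sum with \<open>a\<close> and \<open>b\<close> exchanged is the derivative of
  the induced metric; these properties determine it.\<close>
lemma koszul:
  assumes "u \<in> D"
  shows "(\<Sum>h\<in>UNIV. g u $ b $ h * christoffel g u h c a) = ip u (cov \<Gamma> x c (pd a x) u) (pd b x u)"
proof -
  let ?K = "\<lambda>c a b. ip u (cov \<Gamma> x c (pd a x) u) (pd b x u)"
  have "pd c (\<lambda>q. g q $ a $ b) u = ?K c a b + ?K c b a" for a b c
    using assms pd_ip[OF assms differentiable_x(2)[OF assms] differentiable_x(2)[OF assms], of c a b]
      met_commute[OF x_in[OF assms]] by simp
  moreover have "?K c a b = ?K a c b" for a b c by (simp only: cov_pd_commute[OF assms])
  ultimately show ?thesis
    using S.christoffel_lower[OF assms, of b c a] by simp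
qed

lemma Ck_on_tangent:
  assumes "Ck_on 2 D W"
  shows "Ck_on 2 D (\<lambda>v. tangent x v (W v))"
  unfolding tangent_def
  by (intro Ck_on_sum[OF open_D] Ck_on_scaleR[OF open_D] Ck_on_vec_nth[OF open_D assms] pd_x_C2)

lemma differentiable_tangent:
  assumes "u \<in> D" "W differentiable at u"
  shows "(\<lambda>v. tangent x v (W v)) differentiable at u"
  unfolding tangent_def
  using assms differentiable_x(2) by (intro differentiable_sum' differentiable_scaleR) auto

text \<open>By linearity it suffices to pair with the coordinate tangent vectors, where the
  derivatives of the coefficients agree on both sides and the remaining terms are compared by
  Koszul's formula.\<close>
lemma gauss_formula:
  assumes u: "u \<in> D" and W: "W differentiable at u"
  shows "ip u (cov \<Gamma> x c (\<lambda>v. tangent x v (W v)) u) (tangent x u w) =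
    met g u (cov (christoffel g) (\<lambda>q. q) c W u) w"
proof -
  have lower: "met g u (conn (christoffel g) u (axis c 1) (W u)) (axis b 1) =
      (\<Sum>a\<in>UNIV. W u $ a * ip u (cov \<Gamma> x c (pd a x) u) (pd b x u))" for b
  proof -
    have "conn (christoffel g) u (axis c 1) (W u) = (\<Sum>a\<in>UNIV. W u $ a *\<^sub>R conn (christoffel g) u (axis c 1) (axis a 1))"
    proof -
      have "W u = (\<Sum>a\<in>UNIV. W u $ a *\<^sub>R axis a 1)"
        by (simp add: basis_expansion flip: scalar_mult_eq_scaleR)
      from arg_cong[OF this, of "conn (christoffel g) u (axis c 1)"] show ?thesis
        by (simp only: conn_scaleR_right conn_sum_right)
    qed
    moreover have "conn (christoffel g) u (axis c 1) (axis a 1) = (\<chi> h. christoffel g u h c a)" for a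
    proof -
      have "(\<Sum>j\<in>UNIV. \<Sum>k\<in>UNIV. christoffel g u h j k * axis c 1 $ j * axis a 1 $ k) =
        (\<Sum>j\<in>UNIV. if j = c then \<Sum>k\<in>UNIV. if k = a then christoffel g u h j k else 0 else 0)" for h
        by (intro sum.cong refl) (simp add: axis_def mult_delta_right)
      then show ?thesis by (simp add: conn_def vec_eq_iff)
    qed
    moreover have "met g u v (axis b 1) = (\<Sum>h\<in>UNIV. g u $ b $ h * v $ h)" for v
      using linear_expand[OF linear_met_left, of g u v "axis b 1"] S.G_commute[OF u]
      by (simp add: met_axis mult.commute)
    ultimately show ?thesis
      by (simp add: met_sum_left met_scaleR_left flip: koszul[OF u])
  qed
  have "ip u (cov \<Gamma> x c (\<lambda>v. tangent x v (W v)) u) (pd b x u) =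
      met g u (cov (christoffel g) (\<lambda>q. q) c W u) (axis b 1)" for b
  proof -
    have "cov \<Gamma> x c (\<lambda>v. tangent x v (W v)) u =
        tangent x u (pd c W u) + (\<Sum>a\<in>UNIV. W u $ a *\<^sub>R cov \<Gamma> x c (pd a x) u)"
      unfolding tangent_def
      using W differentiable_x(2)[OF u] by (simp add: cov_sum_scaleR pd_vec_nth sum.distrib)
    then have "ip u (cov \<Gamma> x c (\<lambda>v. tangent x v (W v)) u) (pd b x u) =
        ip u (tangent x u (pd c W u)) (tangent x u (axis b 1)) +
        (\<Sum>a\<in>UNIV. W u $ a * ip u (cov \<Gamma> x c (pd a x) u) (pd b x u))"
      by (simp add: met_add_left met_sum_left met_scaleR_left)
    then show ?thesis
      by (simp only: met_tangent cov_def pd_id met_add_left lower)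
  qed
  then have "met g u (cov (christoffel g) (\<lambda>q. q) c W u) w =
    (\<Sum>b\<in>UNIV. w $ b * ip u (cov \<Gamma> x c (\<lambda>v. tangent x v (W v)) u) (pd b x u))"
    using linear_expand[OF linear_met_right, of g u "cov (christoffel g) (\<lambda>q. q) c W u" w] by simp
  then show ?thesis
    by (simp add: tangent_def[of _ _ w] met_sum_right met_scaleR_right)
qed

text \<open>The coefficients, in the coordinate basis, of the orthogonal projection of
  \<open>A\<close> onto the tangent space; \<open>perp\<close> is the complementary projection onto
  the normal space.\<close>
definition tan_coeff :: "real^'n \<Rightarrow> real^'m \<Rightarrow> real^'n" where
  "tan_coeff u A = (\<chi> a. \<Sum>b\<in>UNIV. upper g u a b * ip u A (pd b x u))"

definition perp :: "real^'n \<Rightarrow> real^'m \<Rightarrow> real^'m" where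
  "perp u A = A - tangent x u (tan_coeff u A)"

lemma met_tan_coeff:
  assumes "u \<in> D"
  shows "met g u (tan_coeff u A) w = ip u A (tangent x u w)"
proof -
  have "met g u (tan_coeff u A) (axis c 1) = ip u A (pd c x u)" for c
  proof -
    have "met g u (tan_coeff u A) (axis c 1) =
        (\<Sum>a\<in>UNIV. (\<Sum>b\<in>UNIV. upper g u a b * ip u A (pd b x u)) * g u $ a $ c)"
      using linear_expand[OF linear_met_left, of g u "tan_coeff u A" "axis c 1"]
      by (simp add: met_axis tan_coeff_def del: induced_metric_nth)
    also have "\<dots> = (\<Sum>a\<in>UNIV. \<Sum>b\<in>UNIV. g u $ c $ a * upper g u a b * ip u A (pd b x u))"
      by (simp add: sum_distrib_left S.G_commute[OF assms, of _ c] mult_ac del: induced_metric_nth)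
    also have "\<dots> = (\<Sum>b\<in>UNIV. (\<Sum>a\<in>UNIV. g u $ c $ a * upper g u a b) * ip u A (pd b x u))"
      by (subst sum.swap) (simp only: sum_distrib_right)
    also have "\<dots> = (\<Sum>b\<in>UNIV. if b = c then ip u A (pd b x u) else 0)"
      by (intro sum.cong refl) (simp add: S.upper_mult_G(2)[OF assms] del: induced_metric_nth)
    finally show ?thesis by simp
  qed
  then have "met g u (tan_coeff u A) w = (\<Sum>b\<in>UNIV. w $ b * ip u A (pd b x u))"
    using linear_expand[OF linear_met_right, of g u "tan_coeff u A" w] by simp
  then show ?thesis by (simp add: tangent_def met_sum_right met_scaleR_right)
qed

text \<open>Besides identifying the tangential part, this is the source of differentiability for
  intrinsic covariant derivatives, as the right-hand side involves the induced metric without its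
  derivatives.\<close>
lemma cov_eq_tan_coeff:
  assumes "u \<in> D" "W differentiable at u"
  shows "cov (christoffel g) (\<lambda>q. q) c W u = tan_coeff u (cov \<Gamma> x c (\<lambda>v. tangent x v (W v)) u)"
  using assms by (intro S.met_nondegenerate[OF assms(1)]) (simp add: met_tan_coeff gauss_formula)

lemma ip_perp_tangent:
  assumes "u \<in> D" shows "ip u (perp u A) (tangent x u w) = 0" "ip u (tangent x u w) (perp u A) = 0"
proof -
  show "ip u (perp u A) (tangent x u w) = 0"
    using met_tan_coeff[OF assms, of A w] by (simp add: perp_def met_diff_left met_tangent)
  then show "ip u (tangent x u w) (perp u A) = 0" using met_commute[OF x_in[OF assms]] by simp
qed

lemma ip_perp_right:
  assumes "u \<in> D" shows "ip u (perp u A) (perp u B) = ip u (perp u A) B"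
proof -
  have "ip u (perp u A) (perp u B) = ip u (perp u A) B - ip u (perp u A) (tangent x u (tan_coeff u B))"
    by (simp only: perp_def[of u B] met_diff_right)
  then show ?thesis by (simp add: ip_perp_tangent[OF assms])
qed

lemma differentiable_tan_coeff:
  assumes "u \<in> D" "A differentiable at u"
  shows "(\<lambda>v. tan_coeff v (A v)) differentiable at u"
proof (rule differentiable_vec_lambda)
  fix a
  have "(\<lambda>v. \<Sum>b\<in>UNIV. upper g v a b * ip v (A v) (pd b x v)) differentiable at u"
    using assms differentiable_x
    by (intro differentiable_sum' differentiable_mult S.differentiable_upper differentiable_ip)
  then show "(\<lambda>v. tan_coeff v (A v) $ a) differentiable at u" by (simp add: tan_coeff_def)
qed

lemma linear_tan_coeff: "linear (tan_coeff u)"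
  by (intro linearI) (simp_all add: tan_coeff_def vec_eq_iff met_add_left met_scaleR_left
      distrib_left sum.distrib sum_distrib_left mult_ac)

lemma linear_perp: "linear (perp u)"
  unfolding perp_def[abs_def]
  by (intro linearI) (simp_all add: linear_add[OF linear_tan_coeff] linear_scale[OF linear_tan_coeff]
      linear_add[OF linear_tangent] linear_scale[OF linear_tangent] algebra_simps)

text \<open>The ambient derivative \<open>\<nabla>\<^sub>w Y\<close> of a tangential field, in a
  direction \<open>w\<close> tangent at \<open>u\<close>; its normal part is the second fundamental
  form \<open>II(w, Y)\<close>.\<close>
definition cov_tangent :: "real^'n \<Rightarrow> (real^'n \<Rightarrow> real^'n) \<Rightarrow> real^'n \<Rightarrow> real^'m" where
  "cov_tangent u Y w = (\<Sum>c\<in>UNIV. w $ c *\<^sub>R cov \<Gamma> x c (\<lambda>v. tangent x v (Y v)) u)"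

text \<open>By the Gauss formula, \<open>tangent (C j Y)\<close> is \<open>E j Y\<close> minus its
  normal part. The normal part is orthogonal to \<open>X\<close> everywhere, so pairing its
  derivative with \<open>X\<close> gives minus the pairing of the normal part with the derivative of
  \<open>X\<close>.\<close>
lemma second_cov_gauss:
  assumes u: "u \<in> D" and Y: "Ck_on 2 D Y" and X: "X differentiable at u"
  defines "E \<equiv> \<lambda>c W. cov \<Gamma> x c (\<lambda>v. tangent x v (W v))"
  defines "C \<equiv> cov (christoffel g) (\<lambda>q. q)"
  shows "C j Y differentiable at u"
    and "met g u (C k (C j Y) u) (X u) =
      ip u (cov \<Gamma> x k (E j Y) u) (tangent x u (X u)) + ip u (perp u (E j Y u)) (perp u (E k X u))"
proof -
  note dY = Ck_on_2D(1)[OF Y open_D]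
  have CY: "C j Y v = tan_coeff v (E j Y v)" if "v \<in> D" for v
    using cov_eq_tan_coeff[OF that dY[OF that]] by (simp add: C_def E_def)
  have dE: "E j Y differentiable at u"
    unfolding E_def using Ck_on_2D[OF Ck_on_tangent[OF Y] open_D u] differentiable_x[OF u]
      differentiable_\<Gamma>[OF x_in[OF u]]
    by (intro differentiable_cov)
  show dC: "C j Y differentiable at u"
    by (rule differentiable_cong_open[OF open_D u CY differentiable_tan_coeff[OF u dE]])
  note dtX = differentiable_tangent[OF u X] and dtC = differentiable_tangent[OF u dC]
  let ?N = "\<lambda>v. E j Y v - tangent x v (C j Y v)"
  have dN: "?N differentiable at u" using dE dtC by simp
  have N: "?N v = perp v (E j Y v)" if "v \<in> D" for v
    by (simp add: perp_def CY[OF that])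
  have "pd k (\<lambda>v. ip v (?N v) (tangent x v (X v))) u = pd k (\<lambda>v. 0::real) u"
    using N ip_perp_tangent by (intro pd_cong_open[OF open_D u]) simp
  then have 0: "ip u (cov \<Gamma> x k ?N u) (tangent x u (X u)) = - ip u (perp u (E j Y u)) (perp u (E k X u))"
    using pd_ip[OF u dN dtX, of k] N[OF u] by (simp add: E_def ip_perp_right[OF u])
  have "cov \<Gamma> x k ?N u = cov \<Gamma> x k (E j Y) u - cov \<Gamma> x k (\<lambda>v. tangent x v (C j Y v)) u"
    using dE dtC linear_diff[OF linear_conn_right] by (simp add: cov_def pd_diff)
  then show "met g u (C k (C j Y) u) (X u) =
      ip u (cov \<Gamma> x k (E j Y) u) (tangent x u (X u)) + ip u (perp u (E j Y u)) (perp u (E k X u))"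
    using 0 gauss_formula[OF u dC, of k "X u"] by (simp add: C_def met_diff_left)
qed

text \<open>Antisymmetrize \<open>second_cov_gauss\<close> in the two directions and apply the Ricci
  identity to the ambient second derivatives.\<close>
theorem gauss_equation:
  assumes u: "u \<in> D" and Y: "Ck_on 2 D Y"
    and X: "X differentiable at u" and Z: "Z differentiable at u" and V: "V differentiable at u"
  shows "riem g X Y Z V u =
    riem_at G (x u) (tangent x u (X u)) (tangent x u (Y u)) (tangent x u (Z u)) (tangent x u (V u))
    + ip u (perp u (cov_tangent u X (Z u))) (perp u (cov_tangent u Y (V u)))
    - ip u (perp u (cov_tangent u X (V u))) (perp u (cov_tangent u Y (Z u)))"
proof -
  let ?C = "cov (christoffel g) (\<lambda>q. q)" and ?tX = "tangent x u (X u)" and ?tY = "\<lambda>v. tangent x v (Y v)"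
  let ?H = "\<lambda>W k. perp u (cov \<Gamma> x k (\<lambda>v. tangent x v (W v)) u)"
  have comm: "met g u (?C k (?C j Y) u - ?C j (?C k Y) u) (X u) =
      ip u (curv \<Gamma> (x u) (pd k x u) (pd j x u) (?tY u)) ?tX
      + ip u (?H Y j) (?H X k) - ip u (?H Y k) (?H X j)" for j k
  proof -
    have R: "curv \<Gamma> (x u) (pd k x u) (pd j x u) (?tY u) =
        cov \<Gamma> x k (cov \<Gamma> x j ?tY) u - cov \<Gamma> x j (cov \<Gamma> x k ?tY) u"
      using differentiable_\<Gamma>[OF x_in[OF u]]
      by (intro ricci_identity[OF open_D u x_C2 Ck_on_tangent[OF Y], symmetric])
    show ?thesis
      using second_cov_gauss(2)[OF u Y X, of k j] second_cov_gauss(2)[OF u Y X, of j k]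
      by (simp add: R met_diff_left)
  qed
  have perp_dir: "perp u (cov_tangent u W w) = (\<Sum>c\<in>UNIV. w $ c *\<^sub>R ?H W c)" for W w
    by (simp add: cov_tangent_def linear_sum[OF linear_perp] linear_scale[OF linear_perp])
  have bil: "ip u (\<Sum>j\<in>UNIV. v $ j *\<^sub>R A j) (\<Sum>k\<in>UNIV. z $ k *\<^sub>R B k) =
      (\<Sum>k\<in>UNIV. \<Sum>j\<in>UNIV. (z $ k * v $ j) * ip u (A j) (B k))"
    for A B :: "'n \<Rightarrow> real^'m" and v z :: "real^'n"
    by (simp add: met_sum_left met_sum_right met_scaleR_left met_scaleR_right sum_distrib_left mult_ac)
  have bil': "ip u (\<Sum>k\<in>UNIV. z $ k *\<^sub>R A k) (\<Sum>j\<in>UNIV. v $ j *\<^sub>R B j) =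
      (\<Sum>k\<in>UNIV. \<Sum>j\<in>UNIV. (z $ k * v $ j) * ip u (A k) (B j))"
    for A B :: "'n \<Rightarrow> real^'m" and v z :: "real^'n"
    using bil[where A = A and B = B and v = z and z = v] by (subst sum.swap) (simp add: mult_ac)
  have "riem g X Y Z V u = (\<Sum>k\<in>UNIV. \<Sum>j\<in>UNIV.
      (Z u $ k * V u $ j) * met g u (?C k (?C j Y) u - ?C j (?C k Y) u) (X u))"
    using curvature_op_eq_commutator[OF open_D u Ck_on_2D(1)[OF Y open_D] Z V second_cov_gauss(1)[OF u Y X]]
    by (simp add: riem_def met_sum_left met_scaleR_left)
  also have "\<dots> = (\<Sum>k\<in>UNIV. \<Sum>j\<in>UNIV.
        (Z u $ k * V u $ j) * ip u (curv \<Gamma> (x u) (pd k x u) (pd j x u) (?tY u)) ?tX)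
      + (\<Sum>k\<in>UNIV. \<Sum>j\<in>UNIV. (Z u $ k * V u $ j) * ip u (?H Y j) (?H X k))
      - (\<Sum>k\<in>UNIV. \<Sum>j\<in>UNIV. (Z u $ k * V u $ j) * ip u (?H Y k) (?H X j))"
    unfolding comm by (simp add: sum.distrib sum_subtractf algebra_simps)
  also have "(\<Sum>k\<in>UNIV. \<Sum>j\<in>UNIV.
        (Z u $ k * V u $ j) * ip u (curv \<Gamma> (x u) (pd k x u) (pd j x u) (?tY u)) ?tX) =
      ip u (curv \<Gamma> (x u) (tangent x u (Z u)) (tangent x u (V u)) (?tY u)) ?tX"
    unfolding tangent_def[of x u "Z u"] tangent_def[of x u "V u"]
    by (subst sum.swap) (simp add: linear_sum[OF linear_curv(1)] linear_scale[OF linear_curv(1)]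
        linear_sum[OF linear_curv(2)] linear_scale[OF linear_curv(2)] met_sum_left met_scaleR_left
        sum_distrib_left mult_ac)
  also have "\<dots> = riem_at G (x u) ?tX (?tY u) (tangent x u (Z u)) (tangent x u (V u))"
    using riem_at_eq_curv[OF differentiable_\<Gamma>[OF x_in[OF u]]] by simp
  also have "(\<Sum>k\<in>UNIV. \<Sum>j\<in>UNIV. (Z u $ k * V u $ j) * ip u (?H Y j) (?H X k)) =
      ip u (perp u (cov_tangent u X (Z u))) (perp u (cov_tangent u Y (V u)))"
    by (simp only: perp_dir bil' met_commute[OF x_in[OF u], of "?H Y _"])
  also have "(\<Sum>k\<in>UNIV. \<Sum>j\<in>UNIV. (Z u $ k * V u $ j) * ip u (?H Y k) (?H X j)) =
      ip u (perp u (cov_tangent u X (V u))) (perp u (cov_tangent u Y (Z u)))"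
    by (simp only: perp_dir bil met_commute[OF x_in[OF u], of "?H Y _"])
  finally show ?thesis .
qed

end

section \<open>The gradient, the normal projection and the Weingarten maps from the Poisson bracket\<close>

lemma sum_move_last_5:
  "(\<Sum>i\<in>A. \<Sum>j\<in>B. \<Sum>k\<in>C. \<Sum>l\<in>D. \<Sum>m\<in>E. f i j k l m :: 'b::comm_monoid_add) =
    (\<Sum>m\<in>E. \<Sum>i\<in>A. \<Sum>j\<in>B. \<Sum>k\<in>C. \<Sum>l\<in>D. f i j k l m)"
  by (simp only: sum.swap[of _ _ E])

text \<open>The index sum factors through the contractions of the two derivatives of
  \<open>\<Pi>\<close> with tangential vectors; only the index \<open>m\<close> links them.\<close>
lemma sum_contract_pair:
  fixes X Y Z V :: "real^'m"
  shows "(\<Sum>i\<in>UNIV. \<Sum>j\<in>UNIV. \<Sum>k\<in>UNIV. \<Sum>l\<in>UNIV. X $ i * Y $ j * Z $ k * V $ l *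
      (\<Sum>m\<in>UNIV. L k i m * M l j m)) =
    (\<Sum>m\<in>UNIV. (\<Sum>i\<in>UNIV. X $ i * (\<Sum>k\<in>UNIV. Z $ k * L k i m)) *
      (\<Sum>j\<in>UNIV. Y $ j * (\<Sum>l\<in>UNIV. V $ l * M l j m)))"
proof -
  have "(\<Sum>i\<in>UNIV. \<Sum>j\<in>UNIV. \<Sum>k\<in>UNIV. \<Sum>l\<in>UNIV. X $ i * Y $ j * Z $ k * V $ l *
      (\<Sum>m\<in>UNIV. L k i m * M l j m)) =
    (\<Sum>m\<in>UNIV. \<Sum>i\<in>UNIV. \<Sum>j\<in>UNIV. \<Sum>k\<in>UNIV. \<Sum>l\<in>UNIV.
      (X $ i * (Z $ k * L k i m)) * (Y $ j * (V $ l * M l j m)))"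
    unfolding sum_distrib_left by (subst sum_move_last_5) (simp add: mult_ac)
  also have "\<dots> = (\<Sum>m\<in>UNIV. (\<Sum>i\<in>UNIV. X $ i * (\<Sum>k\<in>UNIV. Z $ k * L k i m)) *
      (\<Sum>j\<in>UNIV. Y $ j * (\<Sum>l\<in>UNIV. V $ l * M l j m)))"
    by (simp only: sum_distrib_left[symmetric] sum_distrib_right[symmetric])
  finally show ?thesis .
qed

lemma riem_at_plus_contractions:
  fixes X Y Z V :: "real^'m"
  shows "(\<Sum>i\<in>UNIV. \<Sum>j\<in>UNIV. \<Sum>k\<in>UNIV. \<Sum>l\<in>UNIV. X $ i * Y $ j * Z $ k * V $ l *
      (riem_comp G p i j k l + (\<Sum>m\<in>UNIV. L k i m * M l j m) - (\<Sum>m\<in>UNIV. L l i m * M k j m))) =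
    riem_at G p X Y Z V
    + (\<Sum>m\<in>UNIV. (\<Sum>i\<in>UNIV. X $ i * (\<Sum>k\<in>UNIV. Z $ k * L k i m)) *
        (\<Sum>j\<in>UNIV. Y $ j * (\<Sum>l\<in>UNIV. V $ l * M l j m)))
    - (\<Sum>m\<in>UNIV. (\<Sum>i\<in>UNIV. X $ i * (\<Sum>l\<in>UNIV. V $ l * L l i m)) *
        (\<Sum>j\<in>UNIV. Y $ j * (\<Sum>k\<in>UNIV. Z $ k * M k j m)))"
proof -
  have "(\<Sum>k\<in>UNIV. \<Sum>l\<in>UNIV. X $ i * Y $ j * Z $ k * V $ l * (\<Sum>m\<in>UNIV. L l i m * M k j m)) =
    (\<Sum>l\<in>UNIV. \<Sum>k\<in>UNIV. X $ i * Y $ j * V $ l * Z $ k * (\<Sum>m\<in>UNIV. L l i m * M k j m))" for i j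
    by (subst sum.swap) (simp add: mult_ac)
  then show ?thesis
    using sum_contract_pair[of X Y Z V L M] sum_contract_pair[of X Y V Z L M]
    by (simp only: riem_at_def distrib_left right_diff_distrib sum.distrib sum_subtractf)
      (simp add: mult_ac)
qed

locale almost_kaehler_coordinates = coordinate_submanifold U G D x
  for U :: "(real^'m) set" and G :: "real^'m \<Rightarrow> real^'m^'m"
    and D :: "(real^'n) set" and x :: "real^'n \<Rightarrow> real^'m" +
  fixes P :: "real^'n \<Rightarrow> real^'n^'n" and \<rho> :: "real^'n \<Rightarrow> real"
  assumes \<rho>_pos: "\<And>u. u \<in> D \<Longrightarrow> 0 < \<rho> u"
    and almost_kaehler: "\<And>u a b. u \<in> D \<Longrightarrow> (\<rho> u)\<^sup>2 * upper (induced_metric G x) u a b =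
      (\<Sum>p\<in>UNIV. \<Sum>q\<in>UNIV. P u $ a $ p * P u $ b $ q * induced_metric G x u $ p $ q)"
begin

text \<open>The bracket with a coordinate function is a component of the vector \<open>grad\<close>,
  the image of \<open>df\<close> under the bivector. So \<open>\<D>\<close> is a metric pairing of
  two such vectors, and the almost Kaehler condition turns the Gram matrix of the images
  \<open>w\<close> of the coordinate differentials into \<open>\<gamma>\<^sup>2
  g\<^sup>a\<^sup>b\<close>.\<close>
lemma \<D>_eq:
  assumes u: "u \<in> D"
  shows "\<D> G x P \<rho> i f u = (\<Sum>a\<in>UNIV. \<Sum>b\<in>UNIV. upper g u a b * pd a f u * pd b x u $ i)"
proof -
  define w where "w a = (\<Sum>b\<in>UNIV. P u $ a $ b *\<^sub>R pd b x u)" for a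
  define grad where "grad h = (\<Sum>a\<in>UNIV. pd a h u *\<^sub>R w a)" for h
  have br: "bracket P h (\<lambda>v. x v $ k) u = grad h $ k" for h k
    by (simp add: bracket_def grad_def w_def pd_vec_nth differentiable_x[OF u] sum_distrib_left mult_ac)
  have "ip u (w a) (w b) = (\<Sum>p\<in>UNIV. \<Sum>q\<in>UNIV. P u $ a $ p * P u $ b $ q * g u $ p $ q)" for a b
    by (simp only: w_def[of a] met_sum_left met_scaleR_left)
      (simp add: w_def met_sum_right met_scaleR_right sum_distrib_left mult_ac)
  then have w: "ip u (w a) (w b) = (\<rho> u)\<^sup>2 * upper g u a b" for a b
    by (simp only: almost_kaehler[OF u])
  have "\<D> G x P \<rho> i f u = 1 / (\<rho> u)\<^sup>2 * ip u (grad f) (grad (\<lambda>v. x v $ i))"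
    by (simp add: \<D>_def br met_def mult_ac)
  also have "ip u (grad f) (grad (\<lambda>v. x v $ i)) =
      (\<Sum>a\<in>UNIV. \<Sum>b\<in>UNIV. pd a f u * pd b x u $ i * ip u (w a) (w b))"
    by (simp only: grad_def[of f] met_sum_left met_scaleR_left)
      (simp add: grad_def met_sum_right met_scaleR_right sum_distrib_left pd_vec_nth
        differentiable_x[OF u] mult_ac)
  finally show ?thesis
    using \<rho>_pos[OF u] by (simp add: w sum_distrib_left mult_ac)
qed

text \<open>The metric pairing of the gradient of \<open>f\<close> with a tangent vector is the
  derivative of \<open>f\<close> in its direction.\<close>
lemma \<D>_lowered:
  assumes u: "u \<in> D"
  shows "(\<Sum>k\<in>UNIV. tangent x u w $ k * (\<Sum>r\<in>UNIV. G (x u) $ k $ r * \<D> G x P \<rho> r f u)) =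
    (\<Sum>a\<in>UNIV. w $ a * pd a f u)"
proof -
  define c where "c = (\<chi> b. \<Sum>a\<in>UNIV. upper g u a b * pd a f u)"
  have axis: "met g u c (axis a 1) = pd a f u" for a
  proof -
    have "met g u c (axis a 1) = (\<Sum>b\<in>UNIV. (\<Sum>d\<in>UNIV. upper g u d b * pd d f u) * g u $ b $ a)"
      using linear_expand[OF linear_met_left, of g u c "axis a 1"]
      by (simp add: met_axis c_def del: induced_metric_nth)
    also have "\<dots> = (\<Sum>d\<in>UNIV. (\<Sum>b\<in>UNIV. upper g u d b * g u $ b $ a) * pd d f u)"
      unfolding sum_distrib_right by (subst sum.swap) (simp add: mult_ac del: induced_metric_nth)
    also have "\<dots> = (\<Sum>d\<in>UNIV. if d = a then pd d f u else 0)"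
      by (intro sum.cong refl) (simp add: S.upper_mult_G(1)[OF u] del: induced_metric_nth)
    finally show ?thesis by simp
  qed
  have "\<D> G x P \<rho> r f u = tangent x u c $ r" for r
    unfolding \<D>_eq[OF u] by (subst sum.swap) (simp add: tangent_def c_def sum_distrib_right)
  then have "(\<Sum>k\<in>UNIV. tangent x u w $ k * (\<Sum>r\<in>UNIV. G (x u) $ k $ r * \<D> G x P \<rho> r f u)) =
      ip u (tangent x u w) (tangent x u c)"
    by (simp add: met_def sum_distrib_left mult_ac)
  also have "\<dots> = (\<Sum>a\<in>UNIV. w $ a * met g u c (axis a 1))"
    unfolding met_tangent S.met_commute[OF u, of w]
    by (rule linear_expand[OF linear_met_right])
  finally show ?thesis by (simp only: axis)
qed

text \<open>The contraction of an upper index with a tangent vector. All hat derivatives are linear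
  in \<open>\<D>\<close>, so this contraction turns them into covariant derivatives.\<close>
definition lowered :: "real^'n \<Rightarrow> real^'n \<Rightarrow> ('m \<Rightarrow> real) \<Rightarrow> real" where
  "lowered u w \<phi> = (\<Sum>k\<in>UNIV. tangent x u w $ k * (\<Sum>r\<in>UNIV. G (x u) $ k $ r * \<phi> r))"

lemma lowered_linear:
  "lowered u w (\<lambda>r. \<phi> r + \<psi> r) = lowered u w \<phi> + lowered u w \<psi>"
  "lowered u w (\<lambda>r. \<phi> r - \<psi> r) = lowered u w \<phi> - lowered u w \<psi>"
  "lowered u w (\<lambda>r. \<phi> r * s) = lowered u w \<phi> * s"
  "lowered u w (\<lambda>r. \<Sum>j\<in>J. \<Phi> j r) = (\<Sum>j\<in>J. lowered u w (\<Phi> j))"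
proof -
  show "lowered u w (\<lambda>r. \<phi> r + \<psi> r) = lowered u w \<phi> + lowered u w \<psi>"
    "lowered u w (\<lambda>r. \<phi> r - \<psi> r) = lowered u w \<phi> - lowered u w \<psi>"
    "lowered u w (\<lambda>r. \<phi> r * s) = lowered u w \<phi> * s"
    by (simp_all add: lowered_def algebra_simps sum.distrib sum_subtractf sum_distrib_left)
  have 0: "lowered u w (\<lambda>r. 0) = 0" by (simp add: lowered_def)
  have add: "lowered u w (\<lambda>r. \<phi> r + \<psi> r) = lowered u w \<phi> + lowered u w \<psi>" for \<phi> \<psi>
    by (simp add: lowered_def algebra_simps sum.distrib)
  show "lowered u w (\<lambda>r. \<Sum>j\<in>J. \<Phi> j r) = (\<Sum>j\<in>J. lowered u w (\<Phi> j))"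
    by (induction J rule: infinite_finite_induct) (simp_all add: 0 add)
qed

lemma lowered_\<D>:
  assumes "u \<in> D"
  shows "lowered u w (\<lambda>r. \<D> G x P \<rho> r f u) = (\<Sum>a\<in>UNIV. w $ a * pd a f u)"
    and "lowered u w (\<lambda>r. \<D> G x P \<rho> r (\<lambda>v. x v $ l) u) = tangent x u w $ l"
  using \<D>_lowered[OF assms]
  by (simp_all add: lowered_def tangent_def pd_vec_nth differentiable_x[OF assms])

lemma lowered_hat_vec:
  assumes u: "u \<in> D" and \<nu>: "\<nu> differentiable at u"
  shows "lowered u w (\<lambda>r. hat_vec G x P \<rho> r \<nu> j u) = (\<Sum>a\<in>UNIV. w $ a *\<^sub>R cov \<Gamma> x a \<nu> u) $ j"
proof -
  have eq: "(\<Sum>a\<in>UNIV. w $ a *\<^sub>R cov \<Gamma> x a \<nu> u) =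
      (\<Sum>a\<in>UNIV. w $ a *\<^sub>R pd a \<nu> u) + conn \<Gamma> (x u) (tangent x u w) (\<nu> u)"
    by (simp add: cov_def scaleR_add_right sum.distrib tangent_def
        linear_sum[OF linear_conn_left] conn_scaleR_left)
  show ?thesis
    unfolding eq hat_vec_def lowered_linear lowered_\<D>(1)[OF u]
    by (simp add: pd_vec_nth[OF \<nu>])
      (simp add: conn_def tangent_def pd_vec_nth differentiable_x[OF u] mult_ac)
qed

lemma lowered_hat_low:
  assumes u: "u \<in> D"
  shows "lowered u w (\<lambda>r. hat_low G x P \<rho> r T i s u) = (\<Sum>a\<in>UNIV. w $ a * pd a (T i s) u)
     - (\<Sum>l\<in>UNIV. \<Sum>h\<in>UNIV. tangent x u w $ l * \<Gamma> (x u) h l i * T h s u)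
     - (\<Sum>l\<in>UNIV. \<Sum>h\<in>UNIV. tangent x u w $ l * \<Gamma> (x u) h l s * T i h u)"
  by (simp add: hat_low_def lowered_linear lowered_\<D>(1)[OF u])
    (simp add: tangent_def pd_vec_nth differentiable_x[OF u])

lemma lowered_hat_mix:
  assumes u: "u \<in> D"
  shows "lowered u w (\<lambda>r. hat_mix G x P \<rho> r T i s u) = (\<Sum>a\<in>UNIV. w $ a * pd a (T i s) u)
     - (\<Sum>l\<in>UNIV. \<Sum>h\<in>UNIV. tangent x u w $ l * \<Gamma> (x u) h l i * T h s u)
     + (\<Sum>l\<in>UNIV. \<Sum>h\<in>UNIV. tangent x u w $ l * \<Gamma> (x u) s l h * T i h u)"
  by (simp add: hat_mix_def lowered_linear lowered_\<D>(1)[OF u])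
    (simp add: tangent_def pd_vec_nth differentiable_x[OF u])

text \<open>The Leibniz rule moves the derivative from \<open>T\<close> to the field that
  \<open>T\<close> annihilates, and the Christoffel term for the contracted index completes it to a
  covariant derivative. The second index of \<open>T\<close> contributes no further term: its
  Christoffel term is again a contraction of \<open>T\<close> with the annihilated field. Hence the
  one lemma serves \<open>\<Pi>\<close> with the second index in either position.\<close>
lemma contract_annihilator:
  assumes u: "u \<in> D" and X: "X differentiable at u"
    and T: "\<And>i. T i s differentiable at u"
    and ann: "\<And>v. v \<in> D \<Longrightarrow> (\<Sum>i\<in>UNIV. tangent x v (X v) $ i * T i s v) = 0"
  shows "(\<Sum>i\<in>UNIV. tangent x u (X u) $ i * ((\<Sum>a\<in>UNIV. w $ a * pd a (T i s) u)
     - (\<Sum>l\<in>UNIV. \<Sum>h\<in>UNIV. tangent x u w $ l * \<Gamma> (x u) h l i * T h s u))) =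
    - (\<Sum>h\<in>UNIV. cov_tangent u X w $ h * T h s u)"
proof -
  let ?tX = "\<lambda>v. tangent x v (X v)"
  note dt = differentiable_tangent[OF u X]
  have leibniz: "(\<Sum>i\<in>UNIV. ?tX u $ i * pd a (T i s) u) = - (\<Sum>i\<in>UNIV. pd a ?tX u $ i * T i s u)" for a
  proof -
    have "pd a (\<lambda>v. \<Sum>i\<in>UNIV. ?tX v $ i * T i s v) u = pd a (\<lambda>v. 0::real) u"
      by (rule pd_cong_open[OF open_D u ann])
    then show ?thesis
      using dt T by (simp add: pd_sum pd_mult pd_vec_nth sum.distrib)
  qed
  have "(\<Sum>i\<in>UNIV. ?tX u $ i * (\<Sum>a\<in>UNIV. w $ a * pd a (T i s) u)) =
      (\<Sum>a\<in>UNIV. w $ a * (\<Sum>i\<in>UNIV. ?tX u $ i * pd a (T i s) u))"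
    unfolding sum_distrib_left by (subst sum.swap) (simp add: mult_ac)
  also have "\<dots> = - (\<Sum>a\<in>UNIV. \<Sum>h\<in>UNIV. w $ a * pd a ?tX u $ h * T h s u)"
    by (simp only: leibniz) (simp add: sum_negf sum_distrib_left mult_ac)
  also have "\<dots> = - (\<Sum>h\<in>UNIV. (\<Sum>a\<in>UNIV. w $ a *\<^sub>R pd a ?tX u) $ h * T h s u)"
    by (subst sum.swap) (simp add: sum_distrib_right)
  finally have 1: "(\<Sum>i\<in>UNIV. ?tX u $ i * (\<Sum>a\<in>UNIV. w $ a * pd a (T i s) u)) = \<dots>" .
  have "(\<Sum>i\<in>UNIV. ?tX u $ i * (\<Sum>l\<in>UNIV. \<Sum>h\<in>UNIV. tangent x u w $ l * \<Gamma> (x u) h l i * T h s u))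
    = (\<Sum>h\<in>UNIV. \<Sum>l\<in>UNIV. \<Sum>i\<in>UNIV. ?tX u $ i * (tangent x u w $ l * \<Gamma> (x u) h l i * T h s u))"
    unfolding sum_distrib_left by (rule sum_swap_1_3)
  also have "\<dots> = (\<Sum>h\<in>UNIV. conn \<Gamma> (x u) (tangent x u w) (?tX u) $ h * T h s u)"
    by (simp add: conn_def sum_distrib_left sum_distrib_right mult_ac)
  finally have 2: "(\<Sum>i\<in>UNIV. ?tX u $ i *
      (\<Sum>l\<in>UNIV. \<Sum>h\<in>UNIV. tangent x u w $ l * \<Gamma> (x u) h l i * T h s u)) = \<dots>" .
  have "cov_tangent u X w = (\<Sum>a\<in>UNIV. w $ a *\<^sub>R pd a ?tX u) + conn \<Gamma> (x u) (tangent x u w) (?tX u)"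
    by (simp add: cov_tangent_def cov_def scaleR_add_right sum.distrib tangent_def[of x u w]
        linear_sum[OF linear_conn_left] conn_scaleR_left)
  then show ?thesis
    by (simp only: right_diff_distrib sum_subtractf 1 2) (simp add: distrib_right sum.distrib)
qed

text \<open>By the gradient formula, the part of \<open>\<Pi>\<close> that comes from
  \<open>\<D>\<close> is the projection onto the tangent space.\<close>
lemma contract_\<Pi>_mix:
  assumes u: "u \<in> D"
  shows "(\<Sum>j\<in>UNIV. A $ j * \<Pi>_mix G x P \<rho> j m u) = perp u A $ m"
proof -
  have "(\<Sum>j\<in>UNIV. A $ j * \<Pi>_mix G x P \<rho> j m u) =
      (\<Sum>j\<in>UNIV. A $ j * (\<Sum>p\<in>UNIV. G (x u) $ j $ p * upper G (x u) p m))
      - (\<Sum>j\<in>UNIV. \<Sum>p\<in>UNIV. A $ j * G (x u) $ j $ p * \<D> G x P \<rho> p (\<lambda>v. x v $ m) u)"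
    by (simp add: \<Pi>_mix_def \<Pi>_up_def right_diff_distrib sum_subtractf sum_distrib_left mult_ac)
  also have "(\<Sum>j\<in>UNIV. A $ j * (\<Sum>p\<in>UNIV. G (x u) $ j $ p * upper G (x u) p m)) = A $ m"
    by (simp add: upper_mult_G(2)[OF x_in[OF u]] mult_delta_right)
  also have "(\<Sum>j\<in>UNIV. \<Sum>p\<in>UNIV. A $ j * G (x u) $ j $ p * \<D> G x P \<rho> p (\<lambda>v. x v $ m) u) =
      tangent x u (tan_coeff u A) $ m"
  proof -
    have Dv: "\<D> G x P \<rho> p (\<lambda>v. x v $ m) u =
        (\<Sum>a\<in>UNIV. pd a x u $ m *\<^sub>R (\<Sum>b\<in>UNIV. upper g u a b *\<^sub>R pd b x u)) $ p" for p
      by (simp add: \<D>_eq[OF u] pd_vec_nth differentiable_x[OF u] sum_distrib_left mult_ac)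
    have "(\<Sum>j\<in>UNIV. \<Sum>p\<in>UNIV. A $ j * G (x u) $ j $ p * \<D> G x P \<rho> p (\<lambda>v. x v $ m) u) =
        ip u A (\<Sum>a\<in>UNIV. pd a x u $ m *\<^sub>R (\<Sum>b\<in>UNIV. upper g u a b *\<^sub>R pd b x u))"
      unfolding Dv met_def by (simp add: mult_ac)
    then show ?thesis
      by (simp add: met_sum_right met_scaleR_right tangent_def tan_coeff_def mult.commute)
  qed
  finally show ?thesis by (simp add: perp_def)
qed

lemma \<Pi>_low_eq: "\<Pi>_low G x P \<rho> i m u = (\<Sum>q\<in>UNIV. G (x u) $ m $ q * \<Pi>_mix G x P \<rho> i q u)"
  unfolding \<Pi>_low_def \<Pi>_mix_def sum_distrib_left by (subst sum.swap) (simp add: mult_ac)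

lemma contract_\<Pi>_low:
  assumes u: "u \<in> D"
  shows "(\<Sum>i\<in>UNIV. A $ i * \<Pi>_low G x P \<rho> i m u) = (\<Sum>q\<in>UNIV. G (x u) $ m $ q * perp u A $ q)"
proof -
  have "(\<Sum>i\<in>UNIV. A $ i * \<Pi>_low G x P \<rho> i m u) =
      (\<Sum>q\<in>UNIV. G (x u) $ m $ q * (\<Sum>i\<in>UNIV. A $ i * \<Pi>_mix G x P \<rho> i q u))"
    unfolding \<Pi>_low_eq sum_distrib_left by (subst sum.swap) (simp add: mult_ac)
  then show ?thesis by (simp add: contract_\<Pi>_mix[OF u])
qed

lemma perp_tangent [simp]:
  assumes "u \<in> D" shows "perp u (tangent x u w) = 0"
proof -
  have "tan_coeff u (tangent x u w) = w"
    by (rule S.met_nondegenerate[OF assms]) (simp add: met_tan_coeff[OF assms] met_tangent)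
  then show ?thesis by (simp add: perp_def)
qed

text \<open>As an orthogonal projection, \<open>\<Pi>\<close> is expressed through the metric, the
  parametrization and its first derivatives, which are all differentiable.\<close>
lemma differentiable_\<Pi>_mix:
  assumes u: "u \<in> D" shows "\<Pi>_mix G x P \<rho> j m differentiable at u"
proof (rule differentiable_cong_open[OF open_D u])
  show "\<Pi>_mix G x P \<rho> j m v = perp v (axis j 1) $ m" if "v \<in> D" for v
  proof -
    have "(\<Sum>i\<in>UNIV. axis j (1::real) $ i * \<Pi>_mix G x P \<rho> i m v) = \<Pi>_mix G x P \<rho> j m v"
      by (simp add: axis_def mult_delta_left)
    then show ?thesis using contract_\<Pi>_mix[OF that, of "axis j 1" m] by simp
  qed
  have "(\<lambda>v. axis j 1 - tangent x v (tan_coeff v (axis j 1))) differentiable at u"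
    by (intro differentiable_diff differentiable_tangent[OF u] differentiable_tan_coeff[OF u]) auto
  then show "(\<lambda>v. perp v (axis j 1) $ m) differentiable at u"
    unfolding perp_def by (rule differentiable_vec_nth)
qed

lemma differentiable_\<Pi>_low:
  assumes u: "u \<in> D" shows "\<Pi>_low G x P \<rho> i m differentiable at u"
proof -
  have "\<Pi>_low G x P \<rho> i m = (\<lambda>v. \<Sum>q\<in>UNIV. G (x v) $ m $ q * \<Pi>_mix G x P \<rho> i q v)"
    by (simp add: fun_eq_iff \<Pi>_low_eq)
  moreover have "\<dots> differentiable at u"
    using differentiable_chain[OF differentiable_x(1)[OF u] differentiable_G[OF x_in[OF u]]]
    by (intro differentiable_sum' differentiable_mult differentiable_\<Pi>_mix[OF u])
  ultimately show ?thesis by simp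
qed

text \<open>A tangential field is annihilated by \<open>\<Pi>\<close>, so the derivative of
  \<open>\<Pi>\<close> on it is minus \<open>\<Pi>\<close> applied to its derivative, that is, minus
  the second fundamental form.\<close>
lemma contract_nabla_\<Pi>_mix:
  assumes u: "u \<in> D" and X: "X differentiable at u"
  shows "(\<Sum>i\<in>UNIV. tangent x u (X u) $ i * (\<Sum>k\<in>UNIV. tangent x u w $ k * nabla_\<Pi>_mix G x P \<rho> k i m u))
    = - perp u (cov_tangent u X w) $ m"
proof -
  let ?T = "\<Pi>_mix G x P \<rho>" and ?tX = "tangent x u (X u)"
  have ann: "(\<Sum>i\<in>UNIV. tangent x v (X v) $ i * ?T i s v) = 0" if "v \<in> D" for v s
    using contract_\<Pi>_mix[OF that, of "tangent x v (X v)" s] that by simp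
  have "(\<Sum>i\<in>UNIV. ?tX $ i * (\<Sum>l\<in>UNIV. \<Sum>h\<in>UNIV. tangent x u w $ l * \<Gamma> (x u) m l h * ?T i h u)) =
      (\<Sum>h\<in>UNIV. \<Sum>l\<in>UNIV. \<Sum>i\<in>UNIV. ?tX $ i * (tangent x u w $ l * \<Gamma> (x u) m l h * ?T i h u))"
    unfolding sum_distrib_left by (rule sum_swap_1_3)
  also have "\<dots> = (\<Sum>h\<in>UNIV. \<Sum>l\<in>UNIV. tangent x u w $ l * \<Gamma> (x u) m l h * (\<Sum>i\<in>UNIV. ?tX $ i * ?T i h u))"
    by (simp add: sum_distrib_left mult_ac)
  finally have 0: "(\<Sum>i\<in>UNIV. ?tX $ i *
      (\<Sum>l\<in>UNIV. \<Sum>h\<in>UNIV. tangent x u w $ l * \<Gamma> (x u) m l h * ?T i h u)) = 0"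
    by (simp add: ann[OF u])
  have "(\<Sum>k\<in>UNIV. tangent x u w $ k * nabla_\<Pi>_mix G x P \<rho> k i m u) =
      lowered u w (\<lambda>r. hat_mix G x P \<rho> r ?T i m u)" for i
    by (simp add: nabla_\<Pi>_mix_def lowered_def)
  then have "(\<Sum>i\<in>UNIV. ?tX $ i * (\<Sum>k\<in>UNIV. tangent x u w $ k * nabla_\<Pi>_mix G x P \<rho> k i m u)) =
      - (\<Sum>h\<in>UNIV. cov_tangent u X w $ h * ?T h m u)"
    using contract_annihilator[OF u X differentiable_\<Pi>_mix[OF u] ann, where s = m and w = w] 0
    by (simp add: lowered_hat_mix[OF u] distrib_left sum.distrib)
  then show ?thesis by (simp add: contract_\<Pi>_mix[OF u])
qed

lemma contract_nabla_\<Pi>_low: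
  assumes u: "u \<in> D" and X: "X differentiable at u"
  shows "(\<Sum>i\<in>UNIV. tangent x u (X u) $ i * (\<Sum>k\<in>UNIV. tangent x u w $ k * nabla_\<Pi>_low G x P \<rho> k i m u))
    = - (\<Sum>q\<in>UNIV. G (x u) $ m $ q * perp u (cov_tangent u X w) $ q)"
proof -
  let ?T = "\<Pi>_low G x P \<rho>" and ?tX = "tangent x u (X u)"
  have ann: "(\<Sum>i\<in>UNIV. tangent x v (X v) $ i * ?T i s v) = 0" if "v \<in> D" for v s
    using contract_\<Pi>_low[OF that, of "tangent x v (X v)" s] that by simp
  have "(\<Sum>i\<in>UNIV. ?tX $ i * (\<Sum>l\<in>UNIV. \<Sum>h\<in>UNIV. tangent x u w $ l * \<Gamma> (x u) h l m * ?T i h u)) =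
      (\<Sum>h\<in>UNIV. \<Sum>l\<in>UNIV. \<Sum>i\<in>UNIV. ?tX $ i * (tangent x u w $ l * \<Gamma> (x u) h l m * ?T i h u))"
    unfolding sum_distrib_left by (rule sum_swap_1_3)
  also have "\<dots> = (\<Sum>h\<in>UNIV. \<Sum>l\<in>UNIV. tangent x u w $ l * \<Gamma> (x u) h l m * (\<Sum>i\<in>UNIV. ?tX $ i * ?T i h u))"
    by (simp add: sum_distrib_left mult_ac)
  finally have 0: "(\<Sum>i\<in>UNIV. ?tX $ i *
      (\<Sum>l\<in>UNIV. \<Sum>h\<in>UNIV. tangent x u w $ l * \<Gamma> (x u) h l m * ?T i h u)) = 0"
    by (simp add: ann[OF u])
  have "(\<Sum>k\<in>UNIV. tangent x u w $ k * nabla_\<Pi>_low G x P \<rho> k i m u) =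
      lowered u w (\<lambda>r. hat_low G x P \<rho> r ?T i m u)" for i
    by (simp add: nabla_\<Pi>_low_def lowered_def)
  then have "(\<Sum>i\<in>UNIV. ?tX $ i * (\<Sum>k\<in>UNIV. tangent x u w $ k * nabla_\<Pi>_low G x P \<rho> k i m u)) =
      - (\<Sum>h\<in>UNIV. cov_tangent u X w $ h * ?T h m u)"
    using contract_annihilator[OF u X differentiable_\<Pi>_low[OF u] ann, where s = m and w = w] 0
    by (simp add: lowered_hat_low[OF u] right_diff_distrib sum_subtractf)
  then show ?thesis by (simp add: contract_\<Pi>_low[OF u])
qed

lemma contract_nabla_\<Pi>_product:
  assumes u: "u \<in> D" and X: "X differentiable at u" and Y: "Y differentiable at u"
  shows "(\<Sum>m\<in>UNIV.
      (\<Sum>i\<in>UNIV. tangent x u (X u) $ i * (\<Sum>k\<in>UNIV. tangent x u z $ k * nabla_\<Pi>_low G x P \<rho> k i m u)) *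
      (\<Sum>j\<in>UNIV. tangent x u (Y u) $ j * (\<Sum>l\<in>UNIV. tangent x u v $ l * nabla_\<Pi>_mix G x P \<rho> l j m u))) =
    ip u (perp u (cov_tangent u X z)) (perp u (cov_tangent u Y v))"
  unfolding contract_nabla_\<Pi>_low[OF u X] contract_nabla_\<Pi>_mix[OF u Y]
  unfolding met_commute[OF x_in[OF u], of "perp u (cov_tangent u X z)"]
  by (simp add: met_def sum_negf sum_distrib_left sum_distrib_right mult_ac)

text \<open>Weingarten's equation: \<open>\<nu>\<close> stays orthogonal to the tangential field
  \<open>X\<close>, so differentiating \<open>\<langle>\<nu>, X\<rangle> = 0\<close> exchanges the
  derivative of \<open>\<nu>\<close> for that of \<open>X\<close>.\<close>
lemma ip_\<B>:
  assumes u: "u \<in> D" and X: "X differentiable at u" and \<nu>: "\<nu> differentiable at u"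
    and normal: "\<And>v a. v \<in> D \<Longrightarrow> ip v (\<nu> v) (pd a x v) = 0"
  shows "ip u (\<B> G x P \<rho> \<nu> u (tangent x u (X u))) (tangent x u w) = (\<rho> u)\<^sup>2 * ip u (\<nu> u) (cov_tangent u X w)"
proof -
  let ?tX = "\<lambda>v. tangent x v (X v)"
  have "ip u (\<B> G x P \<rho> \<nu> u (?tX u)) (tangent x u w) =
      lowered u w (\<lambda>r. \<B> G x P \<rho> \<nu> u (?tX u) $ r)"
    unfolding met_commute[OF x_in[OF u], of _ "tangent x u w"]
    by (simp add: lowered_def met_def sum_distrib_left mult_ac)
  also have "(\<lambda>r. \<B> G x P \<rho> \<nu> u (?tX u) $ r) =
      (\<lambda>r. \<Sum>j\<in>UNIV. \<Sum>k\<in>UNIV. hat_vec G x P \<rho> r \<nu> j u * (- (\<rho> u)\<^sup>2 * G (x u) $ j $ k * ?tX u $ k))"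
    by (simp add: \<B>_def \<B>_comp_def fun_eq_iff mult_ac)
  also have "lowered u w \<dots> = - (\<rho> u)\<^sup>2 * ip u (\<Sum>a\<in>UNIV. w $ a *\<^sub>R cov \<Gamma> x a \<nu> u) (?tX u)"
    unfolding lowered_linear lowered_hat_vec[OF u \<nu>] met_def
    by (simp add: sum_distrib_left sum_negf mult_ac)
  also have "ip u (\<Sum>a\<in>UNIV. w $ a *\<^sub>R cov \<Gamma> x a \<nu> u) (?tX u) = - ip u (\<nu> u) (cov_tangent u X w)"
  proof -
    have "ip u (cov \<Gamma> x a \<nu> u) (?tX u) = - ip u (\<nu> u) (cov \<Gamma> x a ?tX u)" for a
    proof -
      have "pd a (\<lambda>v. ip v (\<nu> v) (?tX v)) u = pd a (\<lambda>v. 0::real) u"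
        by (rule pd_cong_open[OF open_D u])
          (simp add: tangent_def met_sum_right met_scaleR_right normal)
      then show ?thesis using pd_ip[OF u \<nu> differentiable_tangent[OF u X], of a] by simp
    qed
    then show ?thesis
      by (simp add: cov_tangent_def met_sum_left met_scaleR_left met_sum_right met_scaleR_right sum_negf)
  qed
  finally show ?thesis by simp
qed

text \<open>By a dimension count, tangent space and frame together span everything. The difference
  between \<open>perp u E\<close> and its expansion in the frame is orthogonal to both, hence
  zero.\<close>
lemma orthonormal_complement_expansion:
  assumes u: "u \<in> D"
    and normal: "\<And>A a. A \<in> {1..CARD('m) - CARD('n)} \<Longrightarrow> ip u (N A) (pd a x u) = 0"
    and orth: "\<And>A B. \<lbrakk>A \<in> {1..CARD('m) - CARD('n)}; B \<in> {1..CARD('m) - CARD('n)}\<rbrakk> \<Longrightarrow>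
      ip u (N A) (N B) = (if A = B then 1 else 0)"
  shows "ip u (perp u E) (perp u F) = (\<Sum>A = 1..CARD('m) - CARD('n). ip u (N A) E * ip u (N A) F)"
proof -
  let ?I = "{1..CARD('m) - CARD('n)}"
  have NT: "ip u (N A) (tangent x u w) = 0" if "A \<in> ?I" for A w
    using that by (simp add: tangent_def met_sum_right met_scaleR_right normal)
  have inj_t: "inj (tangent x u)"
  proof (rule linear_injective_0[THEN iffD2, OF linear_tangent], intro allI impI)
    fix w assume "tangent x u w = 0"
    then have "met g u w w = ip u 0 0" using met_tangent[of u w w] by simp
    then have "met g u w w = 0" by (simp add: met_def[of G])
    then show "w = 0" using S.G_pos[OF u, of w] by (cases "w = 0") auto
  qed
  have dim_t: "dim (range (tangent x u)) = CARD('n)"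
    using dim_image_eq[OF linear_tangent, of x u UNIV] inj_t by simp
  have le: "CARD('n) \<le> CARD('m)"
    using dim_t dim_subset_UNIV_cart[of "range (tangent x u)"] by simp
  have inj_N: "inj_on N ?I"
  proof (rule inj_onI)
    fix A B assume AB: "A \<in> ?I" "B \<in> ?I" "N A = N B"
    then have "(if A = B then 1 else 0) = (1::real)" using orth[OF AB(1,2)] orth[OF AB(2,2)] by simp
    then show "A = B" by (simp split: if_splits)
  qed
  have comb: "ip u (N B) (\<Sum>A\<in>?I. c A *\<^sub>R N A) = c B" if "B \<in> ?I" for B c
  proof -
    have "ip u (N B) (\<Sum>A\<in>?I. c A *\<^sub>R N A) = (\<Sum>A\<in>?I. if A = B then c A else 0)"
      unfolding met_sum_right met_scaleR_right using orth[OF that] by (intro sum.cong refl) auto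
    then show ?thesis using that by simp
  qed
  have "independent (N ` ?I)"
  proof (rule independent_if_scalars_zero)
    fix f y assume 0: "(\<Sum>x\<in>N ` ?I. f x *\<^sub>R x) = 0" and "y \<in> N ` ?I"
    then obtain B where B: "B \<in> ?I" "y = N B" by blast
    have "(\<Sum>A\<in>?I. f (N A) *\<^sub>R N A) = 0" using 0 by (simp only: sum.reindex[OF inj_N] o_def)
    then have "f (N B) = ip u (N B) 0" using comb[OF B(1), of "\<lambda>A. f (N A)"] by simp
    then show "f y = 0" using B by (simp add: met_def)
  qed simp
  then have dim_n: "dim (span (N ` ?I)) = CARD('m) - CARD('n)"
    using inj_N by (simp add: dim_eq_card_independent card_image)
  have perp_span: "ip u R y = 0" if "y \<in> span (N ` ?I)" "\<And>A. A \<in> ?I \<Longrightarrow> ip u R (N A) = 0" for R y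
    using that(1)
  proof (induction rule: span_induct_alt)
    case base
    then show ?case by (simp add: met_def)
  next
    case (step c z y)
    then show ?case using that(2) by (auto simp: met_add_right met_scaleR_right)
  qed
  have sub_t: "subspace (range (tangent x u))"
    using linear_subspace_image[OF linear_tangent subspace_UNIV] .
  have "range (tangent x u) \<inter> span (N ` ?I) = {0}"
  proof
    show "range (tangent x u) \<inter> span (N ` ?I) \<subseteq> {0}"
    proof
      fix y assume y: "y \<in> range (tangent x u) \<inter> span (N ` ?I)"
      then obtain w where w: "y = tangent x u w" by blast
      have "ip u y (N A) = 0" if "A \<in> ?I" for A
        unfolding w met_commute[OF x_in[OF u], of "tangent x u w" "N A"] by (rule NT[OF that])
      then have "ip u y y = 0" using perp_span[of y y] y by blast
      then show "y \<in> {0}" using G_pos[OF x_in[OF u], of y] by (cases "y = 0") auto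
    qed
    show "{0} \<subseteq> range (tangent x u) \<inter> span (N ` ?I)"
      using subspace_0[OF sub_t] span_zero by simp
  qed
  then have "dim {y + z |y z. y \<in> range (tangent x u) \<and> z \<in> span (N ` ?I)} = CARD('m)"
    using dim_sums_Int[OF sub_t subspace_span, of "N ` ?I"] dim_t dim_n le by simp
  then have "span {y + z |y z. y \<in> range (tangent x u) \<and> z \<in> span (N ` ?I)} = UNIV"
    by (intro dim_eq_full[THEN iffD1]) (simp only: DIM_cart DIM_real mult_1_right)
  then have full: "{y + z |y z. y \<in> range (tangent x u) \<and> z \<in> span (N ` ?I)} = UNIV"
    using span_eq_iff[THEN iffD2, OF subspace_sums[OF sub_t subspace_span]] by metis
  define R where "R = perp u E - (\<Sum>A\<in>?I. ip u (N A) E *\<^sub>R N A)"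
  have N_perp: "ip u (N A) (perp u E) = ip u (N A) E" if "A \<in> ?I" for A E
    using NT[OF that] by (simp add: perp_def met_diff_right)
  have RN: "ip u R (N A) = 0" if "A \<in> ?I" for A
    using comb[OF that, of "\<lambda>A. ip u (N A) E"] N_perp[OF that] met_commute[OF x_in[OF u], of R "N A"]
    by (simp add: R_def met_diff_right)
  have RT: "ip u R (tangent x u w) = 0" for w
    using NT by (simp add: R_def met_diff_left met_sum_left met_scaleR_left ip_perp_tangent[OF u])
  obtain y z where "R = y + z" "y \<in> range (tangent x u)" "z \<in> span (N ` ?I)"
    using full by blast
  then have "ip u R R = 0"
    using RT perp_span[of z R] RN by (auto simp: met_add_right)
  then have "R = 0" using G_pos[OF x_in[OF u], of R] by (cases "R = 0") auto
  then have "perp u E = (\<Sum>A\<in>?I. ip u (N A) E *\<^sub>R N A)" by (simp add: R_def)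
  then show ?thesis
    by (simp add: met_sum_left met_scaleR_left N_perp)
qed

end


section \<open>From charts to coordinates\<close>

lemma chart_inv_coord:
  assumes "is_chart T c" "s \<in> chart_dom c"
  shows "chart_inv c (coord c s) = s"
proof -
  have "chart_dom c \<subseteq> topspace T" using assms(1) openin_subset by (auto simp: is_chart_def)
  then have "inj_on (coord c) (chart_dom c)"
    using assms(1) homeomorphic_imp_injective_map[of "subtopology T (chart_dom c)" _ "coord c"]
    by (auto simp: is_chart_def Int_absorb1)
  then show ?thesis using assms(2) by (simp add: chart_inv_def)
qed

lemma open_coord_image:
  assumes c: "is_chart T c" and W: "openin T W" "W \<subseteq> chart_dom c"
  shows "open (coord c ` W)"
proof -
  have "openin (subtopology T (chart_dom c)) W"
    using W by (auto simp: openin_subtopology)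
  moreover have "open_map (subtopology T (chart_dom c)) (top_of_set (coord c ` chart_dom c)) (coord c)"
    using c homeomorphic_imp_open_map by (auto simp: is_chart_def)
  ultimately have "openin (top_of_set (coord c ` chart_dom c)) (coord c ` W)"
    by (simp add: open_map_def)
  then show ?thesis using c openin_open_trans by (auto simp: is_chart_def)
qed

text \<open>The charts enter only through this lemma; everything after it concerns the coordinate
  representations on the open set \<open>coord d ` W\<close>.\<close>
lemma almost_kaehler_coordinates_of_charts:
  fixes \<eta> :: "('a, 'm::finite) chart \<Rightarrow> real^'m \<Rightarrow> real^'m^'m"
    and \<theta> :: "('a, 'n::finite) chart \<Rightarrow> real^'n \<Rightarrow> real^'n^'n"
  assumes M: "riemannian_manifold TM \<A>M \<eta>" and S: "submanifold TM \<A>M TS \<A>S"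
    and K: "almost_kaehler_poisson \<A>M \<eta> \<A>S \<theta> \<gamma>"
    and c: "c \<in> \<A>M" and d: "d \<in> \<A>S"
    and W: "openin TS W" "W \<subseteq> chart_dom c \<inter> chart_dom d"
  shows "almost_kaehler_coordinates (coord c ` chart_dom c) (\<eta> c) (coord d ` W) (coord_change d c)
    (\<theta> d) (\<gamma> \<circ> chart_inv d)"
proof
  let ?U = "coord c ` chart_dom c" and ?D = "coord d ` W" and ?x = "coord_change d c"
  have chart_c: "is_chart TM c" and chart_d: "is_chart TS d"
    using M S c d by (auto simp: riemannian_manifold_def submanifold_def smooth_manifold_def)
  have G: "smooth_on ?U (\<eta> c)"
    "\<And>q. q \<in> ?U \<Longrightarrow> transpose (\<eta> c q) = \<eta> c q"
    "\<And>q v. q \<in> ?U \<Longrightarrow> v \<noteq> 0 \<Longrightarrow> 0 < v \<bullet> (\<eta> c q *v v)"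
    using M c unfolding riemannian_manifold_def by blast+
  have sub: "?D \<subseteq> coord d ` (chart_dom d \<inter> chart_dom c)" using W(2) by auto
  have "smooth_on (coord d ` (chart_dom d \<inter> chart_dom c)) ?x"
    and imm: "\<And>u. u \<in> coord d ` (chart_dom d \<inter> chart_dom c) \<Longrightarrow> inj (frechet_derivative ?x (at u))"
    using S c d unfolding submanifold_def by blast+
  then have x: "smooth_on ?D ?x" using smooth_on_subset[OF _ sub] by blast
  have inv: "chart_inv d (coord d s) = s" if "s \<in> W" for s
    using chart_inv_coord[OF chart_d] that W(2) by auto
  show "open ?U" using chart_c by (simp add: is_chart_def)
  show "open ?D" using open_coord_image[OF chart_d W(1)] W(2) by simp
  show "Ck_on 2 ?U (\<eta> c)" using G(1) by (simp add: smooth_on_def)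
  show "Ck_on 3 ?D ?x" using x by (simp add: smooth_on_def)
  show "(\<lambda>q. \<eta> c q $ i $ j) differentiable at q" if "q \<in> ?U" for q i j
  proof -
    have "Ck_on 2 ?U (\<lambda>q. \<eta> c q $ i $ j)"
      by (intro Ck_on_vec_nth[OF \<open>open ?U\<close>] \<open>Ck_on 2 ?U (\<eta> c)\<close>)
    then show ?thesis using Ck_on_2D(1) \<open>open ?U\<close> that by blast
  qed
  show "\<eta> c q $ i $ j = \<eta> c q $ j $ i" if "q \<in> ?U" for q i j
    using arg_cong[OF G(2)[OF that], of "\<lambda>A. A $ j $ i"] by (simp add: transpose_def)
  show "0 < met (\<eta> c) q v v" if "q \<in> ?U" "v \<noteq> 0" for q v
    using G(3)[OF that] by (simp add: met_eq_inner)
  fix u assume u: "u \<in> ?D"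
  then obtain s where s: "s \<in> W" "u = coord d s" by blast
  show "?x u \<in> ?U" using s W(2) inv by (auto simp: coord_change_def)
  show "inj (frechet_derivative ?x (at u))" using imm sub u by blast
  show "0 < (\<gamma> \<circ> chart_inv d) u"
    using K d s W(2) inv unfolding almost_kaehler_poisson_def by auto
  show "((\<gamma> \<circ> chart_inv d) u)\<^sup>2 * upper (induced_metric (\<eta> c) ?x) u a b =
      (\<Sum>p\<in>UNIV. \<Sum>q\<in>UNIV. \<theta> d u $ a $ p * \<theta> d u $ b $ q * induced_metric (\<eta> c) ?x u $ p $ q)" for a b
  proof -
    have "s \<in> chart_dom c \<inter> chart_dom d" using s W(2) by blast
    then show ?thesis
      using K c d s inv unfolding almost_kaehler_poisson_def Let_def by auto
  qed
qed

theorem proposition4p6: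
  fixes TM TS :: "'a topology"
    and \<A>M :: "('a, 'm::finite) chart set"
    and \<A>S :: "('a, 'n::finite) chart set"
    and \<eta> :: "('a, 'm) chart \<Rightarrow> real^'m \<Rightarrow> real^'m^'m"
    and \<theta> :: "('a, 'n) chart \<Rightarrow> real^'n \<Rightarrow> real^'n^'n"
    and \<gamma> :: "'a \<Rightarrow> real"
    and c :: "('a, 'm) chart" and d :: "('a, 'n) chart"
    and W :: "'a set"
    and N :: "nat \<Rightarrow> real^'n \<Rightarrow> real^'m"
    and X Y Z V :: "real^'n \<Rightarrow> real^'n"
    and G :: "real^'m \<Rightarrow> real^'m^'m" and P :: "real^'n \<Rightarrow> real^'n^'n"
    and x :: "real^'n \<Rightarrow> real^'m" and \<rho> :: "real^'n \<Rightarrow> real"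
    and D :: "(real^'n) set" and u :: "real^'n"
  assumes "riemannian_manifold TM \<A>M \<eta>"
    and "submanifold TM \<A>M TS \<A>S"
    and "almost_kaehler_poisson \<A>M \<eta> \<A>S \<theta> \<gamma>"
    and "c \<in> \<A>M" and "d \<in> \<A>S"
    and "openin TS W" and "W \<subseteq> chart_dom c \<inter> chart_dom d"
    and "G = \<eta> c" and "P = \<theta> d" and "x = coord_change d c" and "\<rho> = \<gamma> \<circ> chart_inv d"
    and "D = coord d ` W"
    and "normal_frame G x D N"
    and "smooth_on D X" and "smooth_on D Y" and "smooth_on D Z" and "smooth_on D V"
    and "u \<in> D"
  shows
    "riem (induced_metric G x) X Y Z V u =
       (\<Sum>i\<in>UNIV. \<Sum>j\<in>UNIV. \<Sum>k\<in>UNIV. \<Sum>l\<in>UNIV.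
          push x X u $ i * push x Y u $ j * push x Z u $ k * push x V u $ l *
          (riem_comp G (x u) i j k l
           + (\<Sum>m\<in>UNIV. nabla_\<Pi>_low G x P \<rho> k i m u * nabla_\<Pi>_mix G x P \<rho> l j m u)
           - (\<Sum>m\<in>UNIV. nabla_\<Pi>_low G x P \<rho> l i m u * nabla_\<Pi>_mix G x P \<rho> k j m u)))
     \<and>
     (\<Sum>i\<in>UNIV. \<Sum>j\<in>UNIV. \<Sum>k\<in>UNIV. \<Sum>l\<in>UNIV.
          push x X u $ i * push x Y u $ j * push x Z u $ k * push x V u $ l *
          (riem_comp G (x u) i j k l
           + (\<Sum>m\<in>UNIV. nabla_\<Pi>_low G x P \<rho> k i m u * nabla_\<Pi>_mix G x P \<rho> l j m u)
           - (\<Sum>m\<in>UNIV. nabla_\<Pi>_low G x P \<rho> l i m u * nabla_\<Pi>_mix G x P \<rho> k j m u))) =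
       riem_at G (x u) (push x X u) (push x Y u) (push x Z u) (push x V u)
       + 1 / (\<rho> u) ^ 4 * (\<Sum>A = 1..CARD('m) - CARD('n).
           met G (x u) (\<B> G x P \<rho> (N A) u (push x X u)) (push x Z u) *
           met G (x u) (\<B> G x P \<rho> (N A) u (push x Y u)) (push x V u)
           - met G (x u) (\<B> G x P \<rho> (N A) u (push x X u)) (push x V u) *
             met G (x u) (\<B> G x P \<rho> (N A) u (push x Y u)) (push x Z u))"
proof -
  interpret almost_kaehler_coordinates "coord c ` chart_dom c" G D x P \<rho>
    unfolding assms(8-12) by (rule almost_kaehler_coordinates_of_charts[OF assms(1-7)])
  note u = \<open>u \<in> D\<close>
  let ?I = "{1..CARD('m) - CARD('n)}"
  have C2: "Ck_on 2 D F" if "smooth_on D F" for F :: "real^'n \<Rightarrow> real^'n"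
    using that by (simp add: smooth_on_def)
  have diff: "F differentiable at u" if "smooth_on D F" for F :: "real^'n \<Rightarrow> real^'k"
    by (rule Ck_on_2D(1)[OF _ open_D u]) (use that in \<open>simp add: smooth_on_def\<close>)
  note dX = diff[OF assms(14)] and dY = diff[OF assms(15)] and dZ = diff[OF assms(16)]
    and dV = diff[OF assms(17)]
  have push: "push x F u = tangent x u (F u)" for F
    by (simp add: push_def tangent_def vec_eq_iff pd_vec_nth differentiable_x[OF u])
  have frame: "smooth_on D (N A)" "\<And>v a. v \<in> D \<Longrightarrow> met G (x v) (N A v) (pd a x v) = 0"
    "\<And>B. B \<in> ?I \<Longrightarrow> met G (x u) (N A u) (N B u) = (if A = B then 1 else 0)"
    if "A \<in> ?I" for A
    using assms(13) u that unfolding normal_frame_def by blast+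
  let ?II = "\<lambda>F w. perp u (cov_tangent u F w)"
  have bracket: "(\<Sum>i\<in>UNIV. \<Sum>j\<in>UNIV. \<Sum>k\<in>UNIV. \<Sum>l\<in>UNIV.
        push x X u $ i * push x Y u $ j * push x Z u $ k * push x V u $ l *
        (riem_comp G (x u) i j k l
         + (\<Sum>m\<in>UNIV. nabla_\<Pi>_low G x P \<rho> k i m u * nabla_\<Pi>_mix G x P \<rho> l j m u)
         - (\<Sum>m\<in>UNIV. nabla_\<Pi>_low G x P \<rho> l i m u * nabla_\<Pi>_mix G x P \<rho> k j m u))) =
      riem_at G (x u) (push x X u) (push x Y u) (push x Z u) (push x V u)
      + met G (x u) (?II X (Z u)) (?II Y (V u)) - met G (x u) (?II X (V u)) (?II Y (Z u))"
    unfolding riem_at_plus_contractions push contract_nabla_\<Pi>_product[OF u dX dY] ..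
  have weingarten: "met G (x u) (\<B> G x P \<rho> (N A) u (tangent x u (F u))) (tangent x u w)
      = (\<rho> u)\<^sup>2 * met G (x u) (N A u) (cov_tangent u F w)"
    if "A \<in> ?I" "F differentiable at u" for A F w
    using ip_\<B>[OF u that(2) diff[OF frame(1)[OF that(1)]] frame(2)[OF that(1)]] .
  have normal: "met G (x u) (?II F w) (?II F' w') =
      (\<Sum>A\<in>?I. met G (x u) (N A u) (cov_tangent u F w) * met G (x u) (N A u) (cov_tangent u F' w'))"
    for F F' w w'
    using frame(2)[OF _ u] frame(3) by (rule orthonormal_complement_expansion[OF u])
  have "1 / (\<rho> u) ^ 4 * (\<Sum>A\<in>?I.
      met G (x u) (\<B> G x P \<rho> (N A) u (push x X u)) (push x Z u) *
      met G (x u) (\<B> G x P \<rho> (N A) u (push x Y u)) (push x V u)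
      - met G (x u) (\<B> G x P \<rho> (N A) u (push x X u)) (push x V u) *
        met G (x u) (\<B> G x P \<rho> (N A) u (push x Y u)) (push x Z u)) =
    met G (x u) (?II X (Z u)) (?II Y (V u)) - met G (x u) (?II X (V u)) (?II Y (Z u))"
  proof -
    have scale: "1 / r ^ 4 * (r\<^sup>2 * a * (r\<^sup>2 * b) - r\<^sup>2 * c * (r\<^sup>2 * d)) = a * b - c * d"
      if "0 < r" for r a b c d :: real
      using that by (simp add: field_simps power2_eq_square power4_eq_xxxx)
    show ?thesis
      unfolding push normal sum_subtractf[symmetric] sum_distrib_left
      by (intro sum.cong refl) (simp only: weingarten dX dY scale[OF \<rho>_pos[OF u]])
  qed
  then show ?thesis
    using gauss_equation[OF u C2[OF assms(15)] dX dZ dV] bracket by (simp only: push add_diff_eq simp_thms)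
qed

end
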